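(* Let $\mathcal{C}$ be a finite set of constraints. Then $\mathrm{ISO}(\mathcal{C})$ and $\mathrm{ISO}_c(\mathcal{C})$ are in $\mathrm{P}^{\mathrm{NP}}_{||}$.
   Context: A constraint of arity $k$ is a Boolean function $C:\{0,1\}^k\to\{0,1\}$; $C(x_1,\dots,x_k)$ with variables $x_i$ is a constraint application of $C$, and if the $x_i$ may also be constants $0$ or $1$ it is a constraint application with constants. A set of constraint applications is interpreted as the conjunction of its members; two sets are equivalent if they are satisfied by exactly the same assignments. For a permutation $\pi$ of a variable set $X$, $\pi(S)$ is obtained by simultaneously replacing each variable $x$ by $\pi(x)$. $\mathrm{ISO}(\mathcal{C})$: given two sets $S,U$ of constraint applications of $\mathcal{C}$ over the same variable set $X$, decide whether some permutation $\pi$ of $X$ makes $\pi(S)$ equivalent to $U$; $\mathrm{ISO}_c(\mathcal{C})$ is the same with constants allowed. $\mathrm{P}^{\mathrm{NP}}_{||}$ is the class of problems solvable in polynomial time with parallel (non-adaptive) access to an NP oracle. *)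

theory Defs
  imports Main "HOL-Computational_Algebra.Polynomial" "HOL-Combinatorics.Permutations"
begin

section \<open>Words and encodings\<close>

type_synonym word = "bool list"

text \<open>Every list item is announced by \<^term>\<open>True\<close> and the end of the list by \<^term>\<open>False\<close>;
  hence a list encoding is prefix-free whenever the encoding of its items is,
  and prefix-free encodings can be paired by plain concatenation.\<close>

definition enc_list :: "('a \<Rightarrow> word) \<Rightarrow> 'a list \<Rightarrow> word" where
  "enc_list e xs = concat (map (\<lambda>x. True # e x) xs) @ [False]"

definition enc_word :: "word \<Rightarrow> word" where
  "enc_word = enc_list (\<lambda>b. [b])"

definition pair_word :: "word \<Rightarrow> word \<Rightarrow> word" where
  "pair_word x y = enc_word x @ enc_word y"


section \<open>Deterministic multitape Turing machines\<close>

text \<open>Symbols and states are natural numbers. Symbol 0 is the blank, 1 and 2 stand for the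
  bits 0 and 1. A two-way infinite tape is given by the symbols to the left of the head
  (nearest first), the scanned symbol and the symbols to the right of the head; all cells
  beyond the two lists are blank.\<close>

datatype tape = Tape "nat list" (scanned: nat) "nat list"

datatype move = Left | Stay | Right

fun move_head :: "move \<Rightarrow> tape \<Rightarrow> tape" where
  "move_head Stay t = t"
| "move_head Left (Tape [] a rs) = Tape [] 0 (a # rs)"
| "move_head Left (Tape (l # ls) a rs) = Tape ls l (a # rs)"
| "move_head Right (Tape ls a []) = Tape (a # ls) 0 []"
| "move_head Right (Tape ls a (r # rs)) = Tape (a # ls) r rs"

fun write_symbol :: "nat \<Rightarrow> tape \<Rightarrow> tape" where
  "write_symbol b (Tape ls a rs) = Tape ls b rs"

text \<open>The non-halting states are the numbers below \<open>num_states\<close>, the start state is 0 and the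
  halting state is \<open>num_states\<close>. The transition function maps a state and the list of
  scanned symbols to the next state and one pair of written symbol and head move per tape.\<close>

record tm =
  num_tapes :: nat
  num_symbols :: nat
  num_states :: nat
  trans :: "nat \<Rightarrow> nat list \<Rightarrow> nat \<times> (nat \<times> move) list"

definition turing_machine :: "tm \<Rightarrow> bool" where
  "turing_machine M \<longleftrightarrow> num_tapes M \<ge> 1 \<and> num_symbols M \<ge> 3 \<and>
    (\<forall>q ss. q < num_states M \<and> length ss = num_tapes M \<and> set ss \<subseteq> {..<num_symbols M} \<longrightarrow>
      fst (trans M q ss) \<le> num_states M \<and>
      length (snd (trans M q ss)) = num_tapes M \<and>
      (\<forall>(s, m) \<in> set (snd (trans M q ss)). s < num_symbols M))"

type_synonym config = "nat \<times> tape list"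

fun step :: "tm \<Rightarrow> config \<Rightarrow> config" where
  "step M (q, ts) =
    (if q < num_states M
     then let (q', acts) = trans M q (map scanned ts)
          in (q', map2 (\<lambda>(s, m) t. move_head m (write_symbol s t)) acts ts)
     else (q, ts))"

definition bit_symbol :: "bool \<Rightarrow> nat" where
  "bit_symbol b = (if b then 2 else 1)"

fun input_tape :: "word \<Rightarrow> tape" where
  "input_tape [] = Tape [] 0 []"
| "input_tape (b # bs) = Tape [] (bit_symbol b) (map bit_symbol bs)"

definition init_config :: "tm \<Rightarrow> word \<Rightarrow> config" where
  "init_config M x = (0, input_tape x # replicate (num_tapes M - 1) (Tape [] 0 []))"

text \<open>The result of a halting computation is read off the first tape, from the head
  to the right up to the first blank.\<close>

fun tape_content :: "tape \<Rightarrow> nat list" where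
  "tape_content (Tape ls a rs) = takeWhile (\<lambda>s. s \<noteq> 0) (a # rs)"

definition computes_within :: "tm \<Rightarrow> word \<Rightarrow> word \<Rightarrow> nat \<Rightarrow> bool" where
  "computes_within M x y t \<longleftrightarrow>
    (\<exists>t' \<le> t. \<exists>ts. (step M ^^ t') (init_config M x) = (num_states M, ts) \<and>
                 tape_content (hd ts) = map bit_symbol y)"


section \<open>Complexity classes\<close>

definition poly_time_computable :: "(word \<Rightarrow> word) \<Rightarrow> bool" where
  "poly_time_computable f \<longleftrightarrow>
    (\<exists>M (p :: nat poly). turing_machine M \<and>
      (\<forall>x. computes_within M x (f x) (poly p (length x))))"

definition class_P :: "word set set" where
  "class_P = {A. poly_time_computable (\<lambda>x. [x \<in> A])}"

definition class_NP :: "word set set" where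
  "class_NP = {A. \<exists>R \<in> class_P. \<exists>p :: nat poly. \<forall>x.
     x \<in> A \<longleftrightarrow> (\<exists>w. length w \<le> poly p (length x) \<and> pair_word x w \<in> R)}"

text \<open>Parallel access: on input \<open>x\<close> the complete list of queries \<open>Q x\<close> is computed in polynomial
  time without access to the oracle \<open>A\<close>; all queries are then answered at once, and the
  decision is made in polynomial time from \<open>x\<close> and the list of answers.\<close>

definition class_P_NP_par :: "word set set" where
  "class_P_NP_par = {B. \<exists>A \<in> class_NP. \<exists>Q :: word \<Rightarrow> word list. \<exists>D \<in> class_P.
     poly_time_computable (\<lambda>x. enc_list enc_word (Q x)) \<and>
     (\<forall>x. x \<in> B \<longleftrightarrow> pair_word x (map (\<lambda>q. q \<in> A) (Q x)) \<in> D)}"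


section \<open>Constraints and constraint applications\<close>

text \<open>A constraint of arity \<open>k\<close> is a pair \<open>(k, f)\<close>; only the values of \<open>f\<close> on lists of length \<open>k\<close>
  matter. Variable names are words.\<close>

type_synonym constraint = "nat \<times> (bool list \<Rightarrow> bool)"

datatype arg = Var word | Const bool

type_synonym capp = "constraint \<times> arg list"

fun arg_vars :: "arg \<Rightarrow> word set" where
  "arg_vars (Var v) = {v}"
| "arg_vars (Const b) = {}"

definition is_capp_const :: "constraint set \<Rightarrow> word set \<Rightarrow> capp \<Rightarrow> bool" where
  "is_capp_const \<C> X a \<longleftrightarrow> fst a \<in> \<C> \<and> length (snd a) = fst (fst a) \<and>
     (\<forall>r \<in> set (snd a). arg_vars r \<subseteq> X)"

definition is_capp :: "constraint set \<Rightarrow> word set \<Rightarrow> capp \<Rightarrow> bool" where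
  "is_capp \<C> X a \<longleftrightarrow> is_capp_const \<C> X a \<and> (\<forall>r \<in> set (snd a). \<exists>v. r = Var v)"

fun arg_val :: "(word \<Rightarrow> bool) \<Rightarrow> arg \<Rightarrow> bool" where
  "arg_val \<sigma> (Var v) = \<sigma> v"
| "arg_val \<sigma> (Const b) = b"

definition satisfies :: "(word \<Rightarrow> bool) \<Rightarrow> capp set \<Rightarrow> bool" where
  "satisfies \<sigma> S \<longleftrightarrow> (\<forall>((k, f), rs) \<in> S. f (map (arg_val \<sigma>) rs))"

definition equivalent :: "capp set \<Rightarrow> capp set \<Rightarrow> bool" where
  "equivalent S U \<longleftrightarrow> (\<forall>\<sigma>. satisfies \<sigma> S \<longleftrightarrow> satisfies \<sigma> U)"

fun rename_arg :: "(word \<Rightarrow> word) \<Rightarrow> arg \<Rightarrow> arg" where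
  "rename_arg \<pi> (Var v) = Var (\<pi> v)"
| "rename_arg \<pi> (Const b) = Const b"

definition rename :: "(word \<Rightarrow> word) \<Rightarrow> capp set \<Rightarrow> capp set" where
  "rename \<pi> S = (\<lambda>(c, rs). (c, map (rename_arg \<pi>) rs)) ` S"

definition isomorphic :: "word set \<Rightarrow> capp set \<Rightarrow> capp set \<Rightarrow> bool" where
  "isomorphic X S U \<longleftrightarrow> (\<exists>\<pi>. \<pi> permutes X \<and> equivalent (rename \<pi> S) U)"


section \<open>The isomorphism problems\<close>

text \<open>A constraint is encoded by its truth table, whose length \<open>2 ^ k\<close> determines the arity.\<close>

fun enc_constraint :: "constraint \<Rightarrow> word" where
  "enc_constraint (k, f) = enc_word (map f (List.n_lists k [False, True]))"

fun enc_arg :: "arg \<Rightarrow> word" where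
  "enc_arg (Const b) = [False, b]"
| "enc_arg (Var v) = True # enc_word v"

fun enc_capp :: "capp \<Rightarrow> word" where
  "enc_capp (c, rs) = enc_constraint c @ enc_list enc_arg rs"

text \<open>The finite sets \<open>X\<close>, \<open>S\<close> and \<open>U\<close> of an instance are given by listing their elements,
  in any order and possibly with repetitions.\<close>

definition enc_instance :: "word list \<Rightarrow> capp list \<Rightarrow> capp list \<Rightarrow> word" where
  "enc_instance xs ss us = enc_list enc_word xs @ enc_list enc_capp ss @ enc_list enc_capp us"

definition ISO :: "constraint set \<Rightarrow> word set" where
  "ISO \<C> = {enc_instance xs ss us | xs ss us.
     (\<forall>a \<in> set ss \<union> set us. is_capp \<C> (set xs) a) \<and>
     isomorphic (set xs) (set ss) (set us)}"

definition ISO_c :: "constraint set \<Rightarrow> word set" where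
  "ISO_c \<C> = {enc_instance xs ss us | xs ss us.
     (\<forall>a \<in> set ss \<union> set us. is_capp_const \<C> (set xs) a) \<and>
     isomorphic (set xs) (set ss) (set us)}"

end

(*
  Call an application of a constraint of C to variables and constants an application over X, and let
  F(S) be the set of applications over X that some model of S falsifies. Since C is finite, the number
  of applications over X is at most N / 2 for a polynomial N, and pi(S) is equivalent to U iff pi maps F(S)
  onto F(U).
  A family of distinct elements of F(S) and F(U) has a short certificate, namely a falsifying model for
  each element. So for k <= N two questions are in NP: "are there at least k certified elements in
  F(S) and F(U) together?" and "are there at least k certified elements such that, moreover, some
  permutation of X matches the chosen part of F(S) with the chosen part of F(U)?". For k = |F(S)| + |F(U)|
  the second question asks for an isomorphism, and for every other k the answers agree anyway as soon
  as an isomorphism exists. Hence S and U are isomorphic iff the two answers agree for all k <= N, and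
  all these queries can be asked in parallel.

  Polynomial time bounds are obtained from a stack language: data are prefix-free words, a
  polynomial-time function replaces the encoding of its argument on top of stack 0 by the encoding of its
  value and restores all other stacks. As every value is delimited by its own encoding, such programs
  can be composed without renaming stacks, and a stack is a Turing machine tape.
*)

theory Submission
  imports Defs
begin

section \<open>Compiling stack programs to Turing machines\<close>

text \<open>Guessing a permutation does not obviously put the problem into NP, since the equivalence
  of \<pi>(S) and U is a coNP condition. Membership in F(S), in contrast, has a short proof; what no
  certificate can show is that nothing is missing from a family. The count supplies this: each
  certified family is at most as large as the set it comes from, so once the two sizes add up to
  |F(S)| + |F(U)|, both are complete, and one number controls both sets. Finding this number by
  bisection would be adaptive; instead every candidate is tried, and the first question is answered
  yes exactly up to the true number.

  That F(S) determines S up to equivalence rests on the members of S being applications over X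
  themselves: S is equivalent to the conjunction of all applications over X outside F(S). The number
  of applications is polynomial because the arities of a fixed finite C are constants, and a model
  has to be listed on X only. F uses constants in both problems; only the syntax check tells them
  apart.\<close>

datatype cmd =
    Skip
  | Push nat bool
  | Pop nat
  | Seq cmd cmd (infixr ";;" 60)
  | Cond nat "bool option \<Rightarrow> bool" cmd cmd
  | Loop nat "bool option \<Rightarrow> bool" cmd

type_synonym store = "nat \<Rightarrow> word"

fun top_of :: "word \<Rightarrow> bool option" where
  "top_of [] = None"
| "top_of (b # bs) = Some b"

text \<open>The number is the exact count of steps of the compiled code: a push takes two because a
  machine writes before it moves, and a taken branch or a loop round pays for the test and for a
  closing jump.\<close>

inductive exec :: "cmd \<Rightarrow> store \<Rightarrow> nat \<Rightarrow> store \<Rightarrow> bool" where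
  Skip: "exec Skip s 0 s"
| Push: "exec (Push i b) s 2 (s(i := b # s i))"
| Pop: "exec (Pop i) s 1 (s(i := tl (s i)))"
| Seq: "exec c s t s' \<Longrightarrow> exec d s' u s'' \<Longrightarrow> exec (c ;; d) s (t + u) s''"
| CondT: "P (top_of (s i)) \<Longrightarrow> exec c s t s' \<Longrightarrow> exec (Cond i P c d) s (t + 2) s'"
| CondF: "\<not> P (top_of (s i)) \<Longrightarrow> exec d s t s' \<Longrightarrow> exec (Cond i P c d) s (t + 1) s'"
| LoopF: "\<not> P (top_of (s i)) \<Longrightarrow> exec (Loop i P c) s 1 s"
| LoopT: "P (top_of (s i)) \<Longrightarrow> exec c s t s' \<Longrightarrow> exec (Loop i P c) s' u s''
    \<Longrightarrow> exec (Loop i P c) s (t + u + 2) s''"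

fun width :: "cmd \<Rightarrow> nat" where
  "width Skip = 1"
| "width (Push i b) = Suc i"
| "width (Pop i) = Suc i"
| "width (c ;; d) = max (width c) (width d)"
| "width (Cond i P c d) = max (Suc i) (max (width c) (width d))"
| "width (Loop i P c) = max (Suc i) (width c)"

datatype instr = Act nat "nat option" move | Jump nat "bool option \<Rightarrow> bool" nat nat

fun symbol_bit :: "nat \<Rightarrow> bool option" where
  "symbol_bit s = (if s = 0 then None else Some (s = 2))"

text \<open>The two uses of \<open>min\<close> only serve to make every program a valid machine; they have no effect on
  compiled code.\<close>

definition machine :: "nat \<Rightarrow> instr list \<Rightarrow> tm" where
  "machine n code = \<lparr>num_tapes = n, num_symbols = 3, num_states = length code,
     trans = (\<lambda>q ss. case code ! q of
         Act i a m \<Rightarrow> (Suc q, map (\<lambda>j. if j = i then (case a of None \<Rightarrow> ss ! i | Some a \<Rightarrow> min a 2, m) else (ss ! j, Stay)) [0..<length ss])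
       | Jump i P q1 q2 \<Rightarrow> (min (length code) (if P (symbol_bit (ss ! i)) then q1 else q2),
           map (\<lambda>s. (s, Stay)) ss))\<rparr>"

text \<open>Jump targets are absolute, hence the second argument, the address of the first
  instruction. Every block is left at its end, so blocks can be concatenated; a jump with two equal
  targets is unconditional.\<close>

fun compile :: "cmd \<Rightarrow> nat \<Rightarrow> instr list" where
  "compile Skip q = []"
| "compile (Push i b) q = [Act i None Left, Act i (Some (bit_symbol b)) Stay]"
| "compile (Pop i) q = [Act i (Some 0) Right]"
| "compile (c ;; d) q = (let cs = compile c q in cs @ compile d (q + length cs))"
| "compile (Cond i P c d) q =
    (let cs = compile c (q + 1); q' = q + length cs + 2; ds = compile d q'
     in Jump i P (q + 1) q' # cs @ Jump i P (q' + length ds) (q' + length ds) # ds)"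
| "compile (Loop i P c) q =
    (let cs = compile c (q + 1)
     in Jump i P (q + 1) (q + length cs + 2) # cs @ [Jump i P q q])"

definition code_at :: "instr list \<Rightarrow> nat \<Rightarrow> instr list \<Rightarrow> bool" where
  "code_at code q cs \<longleftrightarrow> (\<exists>pre post. code = pre @ cs @ post \<and> length pre = q)"

text \<open>The head scans the top of the stack and popping blanks the scanned cell, so only blanks are left of
  the head.\<close>

definition holds :: "tape \<Rightarrow> word \<Rightarrow> bool" where
  "holds t v \<longleftrightarrow> (\<exists>ls a rs k. t = Tape ls a rs \<and> set ls \<subseteq> {0} \<and>
     a # rs = map bit_symbol v @ replicate k 0)"

lemma turing_machine_machine: "n \<ge> 1 \<Longrightarrow> turing_machine (machine n code)"
  unfolding turing_machine_def machine_def
  by (auto split: instr.splits option.splits if_splits simp: subset_iff nth_mem min_def)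

lemma code_at_append:
  "code_at code q (xs @ ys) \<Longrightarrow> code_at code q xs \<and> code_at code (q + length xs) ys"
  unfolding code_at_def
  by (metis append.assoc length_append)

lemma code_at_Cons:
  assumes "code_at code q (x # xs)"
  shows "code ! q = x" "q < length code" "code_at code (Suc q) xs"
proof -
  from assms obtain pre post where *: "code = pre @ (x # xs) @ post" "length pre = q"
    unfolding code_at_def by blast
  show "code ! q = x" "q < length code" using * by auto
  have "code = (pre @ [x]) @ xs @ post" "length (pre @ [x]) = Suc q" using * by auto
  then show "code_at code (Suc q) xs" unfolding code_at_def by blast
qed

lemma code_at_length: "code_at code q xs \<Longrightarrow> q + length xs \<le> length code"
  unfolding code_at_def by auto

declare step.simps [simp del]

lemma write_scanned [simp]: "write_symbol (scanned t) t = t"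
  by (cases t) simp

lemma step_Act:
  assumes "code ! q = Act i a m" "q < length code" "i < length ts" "\<forall>x. a = Some x \<longrightarrow> x \<le> 2"
  shows "step (machine n code) (q, ts) =
    (Suc q, ts[i := move_head m (write_symbol (case a of None \<Rightarrow> scanned (ts ! i) | Some a \<Rightarrow> a) (ts ! i))])"
  using assms
  by (auto simp: step.simps machine_def nth_list_update min_absorb1 intro!: nth_equalityI split: option.splits)

lemma step_Jump:
  assumes "code ! q = Jump i P q1 q2" "q < length code" "i < length ts"
    "q1 \<le> length code" "q2 \<le> length code"
  shows "step (machine n code) (q, ts) = (if P (symbol_bit (scanned (ts ! i))) then q1 else q2, ts)"
  using assms
  by (auto simp: step.simps machine_def min_absorb1 min_absorb2 intro!: nth_equalityI)

lemma holds_scanned: "holds t v \<Longrightarrow> symbol_bit (scanned t) = top_of v"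
  by (cases v; cases t) (auto simp: holds_def bit_symbol_def Cons_eq_append_conv Cons_replicate_eq split: if_splits)

lemma holdsI: "set ls \<subseteq> {0} \<Longrightarrow> a # rs = map bit_symbol v @ replicate k 0 \<Longrightarrow> holds (Tape ls a rs) v"
  unfolding holds_def by blast

lemma holds_Pop:
  assumes "holds t v"
  shows "holds (move_head Right (write_symbol 0 t)) (tl v)"
proof -
  from assms obtain ls a rs k where t: "t = Tape ls a rs" "set ls \<subseteq> {0}"
      "a # rs = map bit_symbol v @ replicate k 0"
    unfolding holds_def by blast
  show ?thesis
  proof (cases rs)
    case Nil
    then have "tl v = []" using t by (cases v) auto
    then show ?thesis using t Nil by simp (rule holdsI[where k = 1]; simp)
  next
    case (Cons r rs')
    \<comment> \<open>Popping an empty stack moves one of the padding blanks to the left of the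
      head.\<close>
    have "rs = map bit_symbol (tl v) @ replicate (if v = [] then k - 1 else k) 0"
      using t by (cases v; cases k) auto
    then have "holds (Tape (0 # ls) r rs') (tl v)"
      using t(2) Cons by (intro holdsI[where k = "if v = [] then k - 1 else k"]) auto
    then show ?thesis using t(1) Cons by simp
  qed
qed

lemma holds_Push:
  assumes "holds t v"
  shows "holds (write_symbol (bit_symbol b) (move_head Left t)) (b # v)"
  using assms unfolding holds_def
proof (clarify, goal_cases)
  case (1 ls a rs k)
  have "bit_symbol b # a # rs = map bit_symbol (b # v) @ replicate k 0" using 1 by simp
  then show ?case using 1 by (cases ls) fastforce+
qed

text \<open>The program \<open>code\<close> is fixed and merely has to contain the compiled command
  at address \<open>q\<close>. So the induction can descend into subcommands, and after a loop round
  the second hypothesis applies to the same block again. The bound on \<open>width\<close> ensures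
  that all stacks touched have a tape.\<close>

lemma compile_correct:
  assumes "exec c s t s'" "width c \<le> n" "code_at code q (compile c q)"
    "length ts = n" "\<forall>i<n. holds (ts ! i) (s i)"
  shows "\<exists>ts'. (step (machine n code) ^^ t) (q, ts) = (q + length (compile c q), ts') \<and>
    length ts' = n \<and> (\<forall>i<n. holds (ts' ! i) (s' i))"
  using assms
proof (induction arbitrary: q ts rule: exec.induct)
  case (Skip s)
  then show ?case by simp
next
  case (Push i b s)
  let ?M = "machine n code"
  let ?t = "move_head Left (ts ! i)"
  have c: "code ! q = Act i None Left" "q < length code"
    "code ! Suc q = Act i (Some (bit_symbol b)) Stay" "Suc q < length code"
    using Push.prems(2) by (auto dest: code_at_Cons)
  have i: "i < length ts" using Push.prems by simp
  have 1: "step ?M (q, ts) = (Suc q, ts[i := ?t])"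
    using c i by (subst step_Act[OF c(1,2) i]) auto
  have 2: "step ?M (Suc q, ts[i := ?t]) = (Suc (Suc q), ts[i := write_symbol (bit_symbol b) ?t])"
    using c i by (subst step_Act[OF c(3,4)]) (auto simp: bit_symbol_def)
  have "(step ?M ^^ 2) (q, ts) = (Suc (Suc q), ts[i := write_symbol (bit_symbol b) ?t])"
    using 1 2 by (simp add: numeral_2_eq_2)
  moreover have "holds (write_symbol (bit_symbol b) ?t) (b # s i)"
    using Push.prems i by (intro holds_Push) auto
  ultimately show ?case using Push.prems i by (auto simp: nth_list_update)
next
  case (Pop i s)
  let ?M = "machine n code"
  let ?t = "move_head Right (write_symbol 0 (ts ! i))"
  have c: "code ! q = Act i (Some 0) Right" "q < length code"
    using Pop.prems(2) by (auto dest: code_at_Cons)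
  have i: "i < length ts" using Pop.prems by simp
  have "step ?M (q, ts) = (Suc q, ts[i := ?t])"
    using c i by (subst step_Act[OF c(1,2) i]) auto
  moreover have "holds ?t (tl (s i))"
    using Pop.prems i by (intro holds_Pop) auto
  ultimately show ?case using Pop.prems i by (auto simp: nth_list_update)
next
  case (Seq c s t s' d u s'')
  let ?M = "machine n code"
  let ?q = "q + length (compile c q)"
  have at: "code_at code q (compile c q)" "code_at code ?q (compile d ?q)"
    using Seq.prems(2) code_at_append by (auto simp: Let_def)
  obtain ts' where 1: "(step ?M ^^ t) (q, ts) = (?q, ts')" "length ts' = n"
      "\<forall>i<n. holds (ts' ! i) (s' i)"
    using Seq.IH(1)[OF _ at(1) Seq.prems(3,4)] Seq.prems(1) by auto
  obtain ts'' where 2: "(step ?M ^^ u) (?q, ts') = (?q + length (compile d ?q), ts'')" "length ts'' = n"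
      "\<forall>i<n. holds (ts'' ! i) (s'' i)"
    using Seq.IH(2)[OF _ at(2) 1(2,3)] Seq.prems(1) by auto
  show ?case
    using 1 2 by (auto simp: Let_def add.commute[of t u] funpow_add add.assoc)
next
  case (CondT P s i c t s' d)
  let ?M = "machine n code"
  let ?q = "q + 1 + length (compile c (q + 1))"
  let ?q' = "q + length (compile c (q + 1)) + 2"
  let ?e = "?q' + length (compile d ?q')"
  have at: "code ! q = Jump i P (q + 1) ?q'" "q < length code"
      "code_at code (q + 1) (compile c (q + 1))"
      "code_at code ?q (Jump i P ?e ?e # compile d ?q')"
    using code_at_Cons[OF CondT.prems(2)[unfolded compile.simps Let_def]]
      code_at_append[OF code_at_Cons(3)[OF CondT.prems(2)[unfolded compile.simps Let_def]]]
    by (auto simp: add.assoc)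
  have at2: "code ! ?q = Jump i P ?e ?e" "?q < length code" "?e \<le> length code"
    using code_at_Cons[OF at(4)] code_at_length[OF at(4)] by (auto simp: add.assoc)
  have i: "i < length ts" "holds (ts ! i) (s i)" using CondT.prems by auto
  have 1: "step ?M (q, ts) = (q + 1, ts)"
    using at at2 i CondT.hyps holds_scanned[OF i(2)] by (subst step_Jump[OF at(1,2) i(1)]) (auto simp del: symbol_bit.simps)
  obtain ts' where 2: "(step ?M ^^ t) (q + 1, ts) = (?q, ts')" "length ts' = n"
      "\<forall>i<n. holds (ts' ! i) (s' i)"
    using CondT.IH[OF _ at(3) CondT.prems(3,4)] CondT.prems(1) by auto
  have 3: "step ?M (?q, ts') = (?e, ts')"
    using at2 i 2 CondT.prems by (subst step_Jump[OF at2(1,2)]) auto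
  have "(step ?M ^^ (t + 2)) (q, ts) = (step ?M ^^ Suc t) (step ?M (q, ts))"
    by (simp only: funpow_swap1[symmetric] add_2_eq_Suc' funpow.simps o_apply)
  also have "\<dots> = (?e, ts')" using 1 2 3 by (simp)
  finally show ?case using 2 by (auto simp: Let_def)
next
  case (CondF P s i d t s' c)
  let ?M = "machine n code"
  let ?q = "q + 1 + length (compile c (q + 1))"
  let ?q' = "q + length (compile c (q + 1)) + 2"
  let ?e = "?q' + length (compile d ?q')"
  have at: "code ! q = Jump i P (q + 1) ?q'" "q < length code"
      "code_at code ?q (Jump i P ?e ?e # compile d ?q')"
    using code_at_Cons[OF CondF.prems(2)[unfolded compile.simps Let_def]]
      code_at_append[OF code_at_Cons(3)[OF CondF.prems(2)[unfolded compile.simps Let_def]]]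
    by (auto simp: add.assoc)
  have at2: "code_at code ?q' (compile d ?q')" "?e \<le> length code"
    using code_at_Cons[OF at(3)] code_at_length[OF at(3)] by (auto simp: add.assoc)
  have i: "i < length ts" "holds (ts ! i) (s i)" using CondF.prems by auto
  have 1: "step ?M (q, ts) = (?q', ts)"
    using at at2 i CondF.hyps holds_scanned[OF i(2)] by (subst step_Jump[OF at(1,2) i(1)]) (auto simp del: symbol_bit.simps)
  obtain ts' where 2: "(step ?M ^^ t) (?q', ts) = (?e, ts')" "length ts' = n"
      "\<forall>i<n. holds (ts' ! i) (s' i)"
    using CondF.IH[OF _ at2(1) CondF.prems(3,4)] CondF.prems(1) by auto
  have "(step ?M ^^ (t + 1)) (q, ts) = (step ?M ^^ t) (step ?M (q, ts))"
    by (simp only: funpow_swap1[symmetric] Suc_eq_plus1[symmetric] funpow.simps o_apply)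
  also have "\<dots> = (?e, ts')" using 1 2 by (simp)
  finally show ?case using 2 by (auto simp: Let_def)
next
  case (LoopF P s i c)
  let ?M = "machine n code"
  let ?q' = "q + length (compile c (q + 1)) + 2"
  have at: "code ! q = Jump i P (q + 1) ?q'" "q < length code" "?q' \<le> length code"
    using LoopF.prems(2) code_at_length[OF LoopF.prems(2)] by (auto simp: Let_def dest: code_at_Cons)
  have i: "i < length ts" "holds (ts ! i) (s i)" using LoopF.prems by auto
  have 1: "step ?M (q, ts) = (?q', ts)"
    using at i LoopF.hyps holds_scanned[OF i(2)] by (subst step_Jump[OF at(1,2) i(1)]) (auto simp del: symbol_bit.simps)
  then show ?case using LoopF.prems by (auto simp: Let_def)
next
  case (LoopT P s i c t s' u s'')
  let ?M = "machine n code"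
  let ?q = "q + 1 + length (compile c (q + 1))"
  let ?q' = "q + length (compile c (q + 1)) + 2"
  have at: "code ! q = Jump i P (q + 1) ?q'" "q < length code" "?q' \<le> length code"
      "code_at code (q + 1) (compile c (q + 1))"
      "code_at code ?q [Jump i P q q]"
    using code_at_length[OF LoopT.prems(2)] code_at_Cons[OF LoopT.prems(2)[unfolded compile.simps Let_def]]
      code_at_append[OF code_at_Cons(3)[OF LoopT.prems(2)[unfolded compile.simps Let_def]]]
    by (auto simp: add.assoc Let_def)
  have at2: "code ! ?q = Jump i P q q" "?q < length code"
    using code_at_Cons[OF at(5)] by auto
  have i: "i < length ts" "holds (ts ! i) (s i)" using LoopT.prems by auto
  have 1: "step ?M (q, ts) = (q + 1, ts)"
    using at i LoopT.hyps holds_scanned[OF i(2)] by (subst step_Jump[OF at(1,2) i(1)]) (auto simp del: symbol_bit.simps)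
  obtain ts' where 2: "(step ?M ^^ t) (q + 1, ts) = (?q, ts')" "length ts' = n"
      "\<forall>i<n. holds (ts' ! i) (s' i)"
    using LoopT.IH(1)[OF _ at(4) LoopT.prems(3,4)] LoopT.prems(1) by auto
  have 3: "step ?M (?q, ts') = (q, ts')"
    using at at2 i 2 LoopT.prems by (subst step_Jump[OF at2(1,2)]) auto
  obtain ts'' where 4: "(step ?M ^^ u) (q, ts') = (?q', ts'')" "length ts'' = n"
      "\<forall>i<n. holds (ts'' ! i) (s'' i)"
    using LoopT.IH(2)[OF LoopT.prems(1,2) 2(2,3)] by (auto simp: Let_def)
  have "(step ?M ^^ (t + u + 2)) (q, ts) = (step ?M ^^ u) ((step ?M ^^ Suc t) (step ?M (q, ts)))"
    by (simp add: funpow_swap1 funpow_add add.commute[of t u])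
  also have "\<dots> = (?q', ts'')" using 1 2 3 4 by (simp)
  finally show ?case using 4 by (auto simp: Let_def)
qed

text \<open>Bits are nonblank and only blanks follow the word, so the output convention of the
  machine reads off exactly the contents of stack 0.\<close>

lemma computes_within_exec:
  assumes "exec c ((\<lambda>_. [])(0 := x)) t s'" "t \<le> T"
  shows "computes_within (machine (width c) (compile c 0)) x (s' 0) T"
proof -
  let ?n = "width c"
  let ?M = "machine ?n (compile c 0)"
  let ?ts = "input_tape x # replicate (?n - 1) (Tape [] 0 [])"
  have n: "?n \<ge> 1" by (induction c) auto
  have b: "holds (Tape [] 0 []) []"
    unfolding holds_def by (intro exI[of _ "[]"] exI[of _ 0] exI[of _ 1]) auto
  have "holds (input_tape x) x"
    using b by (cases x) (auto simp: holds_def intro!: exI[of _ 0])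
  then have h: "\<forall>i<?n. holds (?ts ! i) (((\<lambda>_. [])(0 := x)) i)"
    using b by (auto simp: nth_Cons split: nat.split)
  have "code_at (compile c 0) 0 (compile c 0)" unfolding code_at_def by auto
  then obtain ts' where ts': "(step ?M ^^ t) (0, ?ts) = (0 + length (compile c 0), ts')"
      "length ts' = ?n" "\<forall>i<?n. holds (ts' ! i) (s' i)"
    using compile_correct[OF assms(1) order_refl _ _ h] n by (metis One_nat_def Suc_pred' length_Cons length_replicate less_eq_Suc_le)
  have "tape_content t = map bit_symbol v" if "holds t v" for t v
    using that unfolding holds_def
    by (auto simp: takeWhile_append bit_symbol_def takeWhile_eq_filter)
  then have "tape_content (hd ts') = map bit_symbol (s' 0)"
    using ts' n by (cases ts') (auto elim!: allE[of _ 0])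
  then show ?thesis
    using assms(2) ts' unfolding computes_within_def init_config_def
    by (intro exI[of _ t]) (auto simp: machine_def)
qed


section \<open>Encodable types\<close>

text \<open>The simulation needs exact times, but upper bounds compose more easily: both branches of
  a conditional can be charged alike.\<close>

definition runs :: "cmd \<Rightarrow> store \<Rightarrow> nat \<Rightarrow> store \<Rightarrow> bool" where
  "runs c s t s' \<longleftrightarrow> (\<exists>t' \<le> t. exec c s t' s')"

lemma runs_Push: "runs (Push i b) s 2 (s(i := b # s i))"
  unfolding runs_def using exec.Push by blast

lemma runs_Pop: "runs (Pop i) s 1 (s(i := tl (s i)))"
  unfolding runs_def using exec.Pop by blast

lemma runs_Skip: "runs Skip s 0 s"
  unfolding runs_def using exec.Skip by blast

lemma runs_Seq: "runs c s t s' \<Longrightarrow> runs d s' u s'' \<Longrightarrow> runs (c ;; d) s (t + u) s''"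
  unfolding runs_def by (meson add_mono exec.Seq)

lemma runs_CondT: "P (top_of (s i)) \<Longrightarrow> runs c s t s' \<Longrightarrow> runs (Cond i P c d) s (t + 2) s'"
  unfolding runs_def by (meson add_le_mono1 exec.CondT)

lemma runs_CondF: "\<not> P (top_of (s i)) \<Longrightarrow> runs d s t s' \<Longrightarrow> runs (Cond i P c d) s (t + 2) s'"
  unfolding runs_def by (meson add_le_mono exec.CondF one_le_numeral)

lemma runs_LoopF: "\<not> P (top_of (s i)) \<Longrightarrow> runs (Loop i P c) s 1 s"
  unfolding runs_def using exec.LoopF by blast

lemma runs_LoopT: "P (top_of (s i)) \<Longrightarrow> runs c s t s' \<Longrightarrow> runs (Loop i P c) s' u s''
    \<Longrightarrow> runs (Loop i P c) s (t + u + 2) s''"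
  unfolding runs_def by (meson add_mono add_le_mono1 exec.LoopT)

lemma runs_conv: "runs c s t s' \<Longrightarrow> s' = s'' \<Longrightarrow> t \<le> u \<Longrightarrow> runs c s u s''"
  unfolding runs_def using le_trans by blast

text \<open>A stack grows by at most one bit per unit of time, so a time bound also bounds the size
  of the result.\<close>

lemma exec_length: "exec c s t s' \<Longrightarrow> length (s' i) \<le> length (s i) + t"
  by (induction rule: exec.induct) auto

lemma runs_length: "runs c s t s' \<Longrightarrow> length (s' i) \<le> length (s i) + t"
  unfolding runs_def using exec_length by (meson add_left_mono le_trans)

text \<open>A word in the process of being moved lies reversed on an auxiliary stack, each bit announced by
  \<^term>\<open>True\<close>, above a \<^term>\<open>False\<close>: reversed encodings do not delimit themselves.\<close>

definition mark :: "word \<Rightarrow> word" where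
  "mark w = concat (map (\<lambda>b. [True, b]) w)"

lemma mark_simps [simp]:
  "mark [] = []" "mark (b # w) = True # b # mark w" "mark (v @ w) = mark v @ mark w"
  by (simp_all add: mark_def)

definition move_bit :: cmd where
  "move_bit = Cond 0 (\<lambda>b. b = Some True) (Pop 0 ;; Push 1 True ;; Push 1 True)
     (Pop 0 ;; Push 1 False ;; Push 1 True)"

lemma runs_move_bit:
  assumes "s 0 = b # r"
  shows "runs move_bit s 7 (s(0 := r, 1 := True # b # s 1))"
proof (cases b)
  case True
  show ?thesis unfolding move_bit_def
    by (rule runs_conv, rule runs_CondT, simp add: assms True, (rule runs_Seq runs_Push runs_Pop)+)
      (auto simp: assms True fun_eq_iff)
next
  case False
  show ?thesis unfolding move_bit_def
    by (rule runs_conv, rule runs_CondF, simp add: assms False, (rule runs_Seq runs_Push runs_Pop)+)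
      (auto simp: assms False fun_eq_iff)
qed

text \<open>\<open>movable\<close> is the only type-specific program: copying, exchanging and discarding values is derived
  from it. \<open>parse\<close> returns an arbitrary value on malformed input.\<close>

class enc =
  fixes encode :: "'a \<Rightarrow> word" and parse :: "word \<Rightarrow> 'a \<times> word"
  assumes parse_encode: "parse (encode x @ r) = (x, r)"
    and length_parse: "length (snd (parse z)) \<le> length z"
    and movable: "\<exists>c k. \<forall>x r s. s 0 = encode x @ r \<longrightarrow>
      runs c s (k * Suc (length (encode x))) (s(0 := r, 1 := mark (rev (encode x)) @ s 1))"

abbreviation sz :: "'a::enc \<Rightarrow> nat" where
  "sz x \<equiv> length (encode x)"

lemma encode_inject [simp]: "encode x = encode y \<longleftrightarrow> x = y"
  by (metis append_Nil2 parse_encode prod.inject)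

section \<open>Encodings of booleans, pairs, lists and arguments\<close>

instantiation bool :: enc
begin

definition encode_bool :: "bool \<Rightarrow> word" where
  "encode_bool b = [b]"

definition parse_bool :: "word \<Rightarrow> bool \<times> word" where
  "parse_bool z = (case z of [] \<Rightarrow> (False, []) | b # z' \<Rightarrow> (b, z'))"

instance
proof
  show "\<exists>c k. \<forall>(x::bool) r s. s 0 = encode x @ r \<longrightarrow>
      runs c s (k * Suc (length (encode x))) (s(0 := r, 1 := mark (rev (encode x)) @ s 1))"
    by (intro exI[of _ move_bit] exI[of _ 7] allI impI, rule runs_conv, erule runs_move_bit[OF trans])
      (auto simp: encode_bool_def)
qed (auto simp: encode_bool_def parse_bool_def split: list.splits)

end

instantiation prod :: (enc, enc) enc
begin

fun encode_prod :: "'a \<times> 'b \<Rightarrow> word" where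
  "encode_prod (a, b) = encode a @ encode b"

definition parse_prod :: "word \<Rightarrow> ('a \<times> 'b) \<times> word" where
  "parse_prod z = (let (a, z1) = parse z; (b, z2) = parse z1 in ((a, b), z2))"

instance
proof
  fix z :: word
  show "length (snd (parse z :: ('a \<times> 'b) \<times> word)) \<le> length z"
    using length_parse[of z, where 'a = 'a] length_parse[of "snd (parse z :: 'a \<times> word)", where 'a = 'b]
    by (auto simp: parse_prod_def split: prod.splits)
next
  obtain c k where c: "\<And>(x::'a) r s. s 0 = encode x @ r \<Longrightarrow>
      runs c s (k * Suc (sz x)) (s(0 := r, 1 := mark (rev (encode x)) @ s 1))"
    using movable[where 'a = 'a] by blast
  obtain d l where d: "\<And>(x::'b) r s. s 0 = encode x @ r \<Longrightarrow>
      runs d s (l * Suc (sz x)) (s(0 := r, 1 := mark (rev (encode x)) @ s 1))"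
    using movable[where 'a = 'b] by blast
  have "runs (c ;; d) s ((k + l) * Suc (length (encode x))) (s(0 := r, 1 := mark (rev (encode x)) @ s 1))"
    if "s 0 = encode x @ r" for x :: "'a \<times> 'b" and r s
  proof (cases x)
    case (Pair a b)
    show ?thesis
      by (rule runs_conv, rule runs_Seq, rule c[of _ a "encode b @ r"], simp add: that Pair,
        rule d[of _ b r], simp) (auto simp: Pair algebra_simps)
  qed
  then show "\<exists>c k. \<forall>(x::'a \<times> 'b) r s. s 0 = encode x @ r \<longrightarrow>
      runs c s (k * Suc (length (encode x))) (s(0 := r, 1 := mark (rev (encode x)) @ s 1))"
    by blast
qed (auto simp: parse_prod_def parse_encode)

end

text \<open>One round of the list parser. The state holds the parsed items in reverse order, the
  rest of the input and whether the end marker was seen. The parser iterates this round with the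
  input word itself as a clock, which makes it total and a fold.\<close>

definition parse_item :: "'a::enc list \<times> word \<times> bool \<Rightarrow> 'a list \<times> word \<times> bool" where
  "parse_item st =
     (if snd (snd st) then st
      else case fst (snd st) of
        [] \<Rightarrow> (fst st, [], True)
      | b # z \<Rightarrow> if b then (let p = parse z in (fst p # fst st, snd p, False)) else (fst st, z, True))"

lemma parse_item_simps [simp]:
  "parse_item (acc, z, True) = (acc, z, True)"
  "parse_item (acc, False # z, False) = (acc, z, True)"
  "parse_item (acc, True # z, False) = (let p = parse z in (fst p # acc, snd p, False))"
  by (simp_all add: parse_item_def)

instantiation list :: (enc) enc
begin

definition encode_list :: "'a list \<Rightarrow> word" where
  "encode_list = enc_list encode"

definition parse_list :: "word \<Rightarrow> 'a list \<times> word" where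
  "parse_list z = (let st = fold (\<lambda>_. parse_item) z ([], z, False) in (rev (fst st), fst (snd st)))"

lemma encode_list_simps [simp]:
  "encode ([] :: 'a list) = [False]"
  "encode (x # xs :: 'a list) = True # encode x @ encode xs"
  by (auto simp: encode_list_def enc_list_def)

instance
proof
  fix z :: word
  have item: "length (fst (snd (parse_item st))) \<le> length (fst (snd st))" for st :: "'a list \<times> word \<times> bool"
    using length_parse[where 'a = 'a] by (auto simp: parse_item_def Let_def le_SucI split: list.splits)
  have "length (fst (snd (fold (\<lambda>_. parse_item) z' st))) \<le> length (fst (snd st))"
    for z' :: word and st :: "'a list \<times> word \<times> bool"
  proof (induction z' arbitrary: st)
    case (Cons b z')
    show ?case using order_trans[OF Cons item] by simp
  qed simp
  then show "length (snd (parse z :: 'a list \<times> word)) \<le> length z"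
    by (metis fst_conv parse_list_def snd_conv)
next
  fix x :: "'a list" and r
  have stop: "fold (\<lambda>_. parse_item) z (acc, r, True) = (acc, r, True)"
    for z :: word and acc :: "'a list" and r
    by (induction z) auto
  \<comment> \<open>Here \<open>z\<close> only counts rounds: one for each item and one for the end
    marker.\<close>
  have "fold (\<lambda>_. parse_item) z (acc, encode x @ r, False) = (rev x @ acc, r, True)"
    if "length z > length x" for z :: word and acc x :: "'a list" and r
    using that
  proof (induction x arbitrary: z acc)
    case Nil
    then show ?case by (cases z) (auto simp: stop)
  next
    case (Cons a x)
    then show ?case by (cases z) (auto simp: Let_def parse_encode)
  qed
  moreover have "length x < length (encode x @ r)"
    by (induction x) auto
  ultimately show "parse (encode x @ r) = (x, r)"
    by (simp add: parse_list_def del: fold_append)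
next
  obtain c k where c: "\<And>(x::'a) r s. s 0 = encode x @ r \<Longrightarrow>
      runs c s (k * Suc (sz x)) (s(0 := r, 1 := mark (rev (encode x)) @ s 1))"
    using movable[where 'a = 'a] by blast
  let ?c = "Loop 0 (\<lambda>b. b = Some True) (move_bit ;; c)"
  \<comment> \<open>The loop halts in front of the final \<open>False\<close> and leaves it on stack
    0, hence \<open>butlast\<close>; one more \<open>move_bit\<close> transports it.\<close>
  have loop: "runs ?c s ((k + 9) * length (encode x))
      (s(0 := False # r, 1 := mark (rev (butlast (encode x))) @ s 1))"
    if "s 0 = encode x @ r" for x :: "'a list" and r s
    using that
  proof (induction x arbitrary: s)
    case Nil
    then show ?case
      by - (rule runs_conv, rule runs_LoopF, auto)
  next
    case (Cons a x)
    have ne: "encode x \<noteq> []" by (cases x) auto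
    show ?case
      apply (rule runs_conv, rule runs_LoopT, use Cons in simp, rule runs_Seq, rule runs_move_bit)
         apply (use Cons in simp)
        apply (rule c[of _ a "encode x @ r"], simp)
       apply (rule Cons.IH, simp)
      using ne by (auto simp: butlast_append algebra_simps)
  qed
  have snoc: "rev (encode x) = False # rev (butlast (encode x))" for x :: "'a list"
    by (simp add: encode_list_def enc_list_def)
  have "runs (?c ;; move_bit) s ((k + 16) * Suc (length (encode x))) (s(0 := r, 1 := mark (rev (encode x)) @ s 1))"
    if "s 0 = encode x @ r" for x :: "'a list" and r s
    apply (rule runs_conv, rule runs_Seq, rule loop[of s x r, OF that], rule runs_move_bit[of _ False r], simp)
    by (auto simp: snoc algebra_simps)
  then show "\<exists>c k. \<forall>(x::'a list) r s. s 0 = encode x @ r \<longrightarrow>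
      runs c s (k * Suc (length (encode x))) (s(0 := r, 1 := mark (rev (encode x)) @ s 1))"
    by blast
qed

end

instantiation arg :: enc
begin

definition encode_arg :: "arg \<Rightarrow> word" where
  "encode_arg = enc_arg"

definition parse_arg :: "word \<Rightarrow> arg \<times> word" where
  "parse_arg z = (case z of [] \<Rightarrow> (Const False, [])
     | b # z' \<Rightarrow> if b then (let p = parse z' in (Var (fst p), snd p)) else (let p = parse z' in (Const (fst p), snd p)))"

lemma encode_arg_simps [simp]:
  "encode (Var v) = True # encode v" "encode (Const b) = False # encode b"
  by (auto simp: encode_arg_def encode_list_def enc_word_def encode_bool_def[abs_def])

instance
proof
  fix z show "length (snd (parse z :: arg \<times> word)) \<le> length z"
    using length_parse[where 'a = bool] length_parse[where 'a = word]
    by (auto simp: parse_arg_def Let_def le_SucI split: list.splits)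
next
  fix x r show "parse (encode x @ r) = (x :: arg, r)"
    by (cases x) (auto simp: parse_arg_def Let_def parse_encode)
next
  obtain c k where c: "\<And>(x::word) r s. s 0 = encode x @ r \<Longrightarrow>
      runs c s (k * Suc (sz x)) (s(0 := r, 1 := mark (rev (encode x)) @ s 1))"
    using movable[where 'a = word] by blast
  have "runs (Cond 0 (\<lambda>b. b = Some True) (move_bit ;; c) (move_bit ;; move_bit)) s ((k + 16) * Suc (length (encode x)))
      (s(0 := r, 1 := mark (rev (encode x)) @ s 1))"
    if s: "s 0 = encode x @ r" for x :: arg and r s
  proof (cases x)
    case (Var v)
    show ?thesis
      by (rule runs_conv, rule runs_CondT, simp add: Var s, rule runs_Seq, rule runs_move_bit,
        simp add: Var s, rule c[of _ v r]) (auto simp: Var s algebra_simps)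
  next
    case (Const b)
    show ?thesis
      by (rule runs_conv, rule runs_CondF, simp add: Const s, rule runs_Seq,
        rule runs_move_bit[of _ False "encode b @ r"], simp add: Const s, rule runs_move_bit[of _ b r]) (auto simp: Const s algebra_simps encode_bool_def)
  qed
  then show "\<exists>c k. \<forall>(x::arg) r s. s 0 = encode x @ r \<longrightarrow>
      runs c s (k * Suc (length (encode x))) (s(0 := r, 1 := mark (rev (encode x)) @ s 1))"
    by blast
qed

end

lemma sz_list_ge [simp]: "length xs < sz (xs :: 'a::enc list)"
  by (induction xs) auto


section \<open>Functions computed in polynomial time\<close>

definition poly_bdd :: "('a::enc \<Rightarrow> nat) \<Rightarrow> bool" where
  "poly_bdd h \<longleftrightarrow> (\<exists>p. \<forall>x. h x \<le> poly p (sz x))"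

lemma poly_mono_nat: "a \<le> b \<Longrightarrow> poly p a \<le> poly p (b :: nat)"
  by (induction p) (auto intro: add_mono mult_mono)

lemma poly_bdd_mono: "poly_bdd h \<Longrightarrow> (\<And>x. h' x \<le> h x) \<Longrightarrow> poly_bdd h'"
  unfolding poly_bdd_def by (meson le_trans)

lemma poly_bdd_const: "poly_bdd (\<lambda>x. n)"
  unfolding poly_bdd_def by (intro exI[of _ "[:n:]"]) simp

lemma poly_bdd_add: "poly_bdd g \<Longrightarrow> poly_bdd h \<Longrightarrow> poly_bdd (\<lambda>x. g x + h x)"
  unfolding poly_bdd_def by (metis add_mono poly_add)

lemma poly_bdd_Suc: "poly_bdd h \<Longrightarrow> poly_bdd (\<lambda>x. Suc (h x))"
  using poly_bdd_add[OF poly_bdd_const[of 1]] by fastforce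

lemma poly_bdd_mult: "poly_bdd g \<Longrightarrow> poly_bdd h \<Longrightarrow> poly_bdd (\<lambda>x. g x * h x)"
  unfolding poly_bdd_def by (metis mult_le_mono poly_mult)

lemma poly_bdd_sz: "poly_bdd (\<lambda>x. sz x)"
  unfolding poly_bdd_def by (intro exI[of _ "[:0, 1:]"]) simp

lemma poly_bdd_poly: "poly_bdd h \<Longrightarrow> poly_bdd (\<lambda>x. poly p (h x))"
  unfolding poly_bdd_def by (metis poly_mono_nat poly_pcompose)

lemma poly_bdd_comp: "poly_bdd h \<Longrightarrow> poly_bdd (\<lambda>x. sz (f x)) \<Longrightarrow> poly_bdd (\<lambda>x. h (f x))"
  unfolding poly_bdd_def by (metis le_trans poly_mono_nat poly_pcompose)

definition computes :: "cmd \<Rightarrow> ('a \<Rightarrow> nat) \<Rightarrow> ('a::enc \<Rightarrow> 'b::enc) \<Rightarrow> bool" where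
  "computes c h f \<longleftrightarrow> (\<forall>x r s. s 0 = encode x @ r \<longrightarrow> runs c s (h x) (s(0 := encode (f x) @ r)))"

definition pt :: "('a::enc \<Rightarrow> 'b::enc) \<Rightarrow> bool" where
  "pt f \<longleftrightarrow> (\<exists>c h. poly_bdd h \<and> computes c h f)"

lemma computesD:
  "computes c h f \<Longrightarrow> s 0 = encode x @ r \<Longrightarrow> runs c s (h x) (s(0 := encode (f x) @ r))"
  unfolding computes_def by blast

lemma ptI:
  "(\<And>x r s. s 0 = encode x @ r \<Longrightarrow> runs c s (h x) (s(0 := encode (f x) @ r))) \<Longrightarrow> poly_bdd h \<Longrightarrow> pt f"
  unfolding pt_def computes_def by blast

lemma ptE:
  assumes "pt f"
  obtains c h where "computes c h f" "poly_bdd h"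
  using assms unfolding pt_def by blast

lemma poly_bdd_pt:
  assumes "pt f"
  shows "poly_bdd (\<lambda>x. sz (f x))"
proof -
  obtain c h where c0: "computes c h (\<lambda>x. (f x))"
    and h: "poly_bdd h"
    using assms by (rule ptE)
  note c = computesD[OF c0]
  have "sz (f x) \<le> sz x + h x" for x
    using runs_length[OF c[of "(\<lambda>_. [])(0 := encode x)" x "[]"], of 0] by simp
  then show ?thesis by (intro poly_bdd_mono[OF poly_bdd_add[OF poly_bdd_sz h]])
qed

lemmas poly_bdd_intros = poly_bdd_add poly_bdd_Suc poly_bdd_mult poly_bdd_sz poly_bdd_poly
  poly_bdd_pt poly_bdd_const

lemma pt_comp:
  assumes "pt f" "pt g"
  shows "pt (\<lambda>x. f (g x))"
proof -
  obtain c h where c0: "computes c h (\<lambda>x. (f x))"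
    and h: "poly_bdd h"
    using assms(1) by (rule ptE)
  note c = computesD[OF c0]
  obtain d k where d0: "computes d k (\<lambda>x. (g x))"
    and k: "poly_bdd k"
    using assms(2) by (rule ptE)
  note d = computesD[OF d0]
  show ?thesis
  proof (rule ptI)
    show "runs (d ;; c) s (k x + h (g x)) (s(0 := encode (f (g x)) @ r))"
      if "s 0 = encode x @ r" for x r s
      by (rule runs_conv, rule runs_Seq, rule d[of s x r, OF that], rule c[of _ "g x" r]) auto
    show "poly_bdd (\<lambda>x. k x + h (g x))"
      by (intro poly_bdd_intros k poly_bdd_comp[OF h] assms)
  qed
qed

lemma pt_id: "pt (\<lambda>x. x)"
  by (rule ptI[where c = Skip and h = "\<lambda>_. 0"])
    (auto intro!: runs_conv[OF runs_Skip] poly_bdd_intros)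

section \<open>Copying, exchanging and discarding values on the stacks\<close>

definition pour :: "nat \<Rightarrow> (bool \<Rightarrow> cmd) \<Rightarrow> cmd" where
  "pour i c = Loop i (\<lambda>b. b = Some True)
     (Pop i ;; Cond i (\<lambda>b. b = Some True) (Pop i ;; c True) (Pop i ;; c False)) ;; Pop i"

text \<open>The \<open>False\<close> below a marked word stands where the next mark would be, so
  pouring stops there whatever lies underneath. By \<open>own\<close> and \<open>comm\<close> the
  action neither changes nor reads stack \<open>i\<close>; hence emptying this stack can be
  separated from the accumulated effect of the action.\<close>

lemma runs_pour:
  assumes c: "\<And>b s. runs (c b) s k (F b s)"
    and own: "\<And>b s. F b s i = s i"
    and comm: "\<And>b s v. F b (s(i := v)) = (F b s)(i := v)"
    and s: "s i = mark w @ False # u"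
  shows "runs (pour i c) s ((k + 8) * Suc (length w)) ((fold F w s)(i := u))"
proof -
  let ?B = "Pop i ;; Cond i (\<lambda>b. b = Some True) (Pop i ;; c True) (Pop i ;; c False)"
  have comm': "fold F w (s(i := v)) = (fold F w s)(i := v)" for w s v
    by (induction w arbitrary: s) (auto simp: comm)
  have own': "fold F w s i = s i" for w s
    by (induction w arbitrary: s) (auto simp: own)
  have body: "runs ?B s (k + 5) (F b (s(i := v)))" if "s i = True # b # v" for s b v
  proof (cases b)
    case True
    show ?thesis
      by (rule runs_conv, rule runs_Seq, rule runs_Pop, rule runs_CondT, simp add: that True,
        rule runs_Seq, rule runs_Pop, rule c) (simp_all add: that True)
  next
    case False
    show ?thesis
      by (rule runs_conv, rule runs_Seq, rule runs_Pop, rule runs_CondF, simp add: that False,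
        rule runs_Seq, rule runs_Pop, rule c) (simp_all add: that False)
  qed
  have "runs (Loop i (\<lambda>b. b = Some True) ?B) s ((k + 7) * length w + 1) ((fold F w s)(i := False # u))"
    using s
  proof (induction w arbitrary: s)
    case Nil
    then show ?case by - (rule runs_conv, rule runs_LoopF, auto)
  next
    case (Cons b w)
    show ?case
      by (rule runs_conv, rule runs_LoopT, simp add: Cons.prems, rule body, simp add: Cons.prems,
        rule Cons.IH) (simp_all only: comm comm' own fun_upd_same fun_upd_upd fold.simps o_apply list.size, simp)
  qed
  then show ?thesis unfolding pour_def
    by - (rule runs_conv, rule runs_Seq, assumption, rule runs_Pop, auto simp: algebra_simps)
qed

lemma fold_push: "fold (\<lambda>b s. s(j := b # s j)) w s = s(j := rev w @ s j)"
  by (induction w arbitrary: s) auto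

lemma fold_push_marked: "fold (\<lambda>b s. s(j := True # b # s j)) w s = s(j := mark (rev w) @ s j)"
  by (induction w arbitrary: s) auto

lemma fold_push_both:
  "fold (\<lambda>b s. s(0 := b # s 0, 2 := True # b # s 2)) w s = s(0 := rev w @ s 0, 2 := mark (rev w) @ s (2::nat))"
  by (induction w arbitrary: s) (auto simp: fun_eq_iff)

lemma runs_Push_marked: "runs (Push j b ;; Push j True) s 4 (s(j := True # b # s j))"
  by (rule runs_conv, (rule runs_Seq runs_Push)+) auto

lemma runs_pour_drop:
  assumes "s i = mark w @ False # u"
  shows "runs (pour i (\<lambda>b. Skip)) s (8 * Suc (length w)) (s(i := u))"
proof -
  have "runs (pour i (\<lambda>b. Skip)) s ((0 + 8) * Suc (length w)) ((fold (\<lambda>b s. s) w s)(i := u))"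
    using assms by (intro runs_pour runs_Skip) auto
  moreover have "fold (\<lambda>b s. s) w s = s" by (induction w) auto
  ultimately show ?thesis by simp
qed

lemma runs_pour_push:
  assumes "s i = mark w @ False # u" "i \<noteq> j"
  shows "runs (pour i (\<lambda>b. Push j b)) s (10 * Suc (length w)) (s(i := u, j := rev w @ s j))"
proof -
  have "runs (pour i (\<lambda>b. Push j b)) s ((2 + 8) * Suc (length w))
      ((fold (\<lambda>b s. s(j := b # s j)) w s)(i := u))"
    using assms by (intro runs_pour runs_Push) auto
  then show ?thesis using assms(2) by (simp add: fold_push fun_upd_twist)
qed

lemma runs_pour_mark:
  assumes "s i = mark w @ False # u" "i \<noteq> j"
  shows "runs (pour i (\<lambda>b. Push j b ;; Push j True)) s (12 * Suc (length w))
    (s(i := u, j := mark (rev w) @ s j))"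
proof -
  have "runs (pour i (\<lambda>b. Push j b ;; Push j True)) s ((4 + 8) * Suc (length w))
      ((fold (\<lambda>b s. s(j := True # b # s j)) w s)(i := u))"
    using assms by (intro runs_pour runs_Push_marked) auto
  then show ?thesis using assms(2) by (simp add: fold_push_marked fun_upd_twist)
qed

lemma runs_pour_both:
  assumes "s 1 = mark w @ False # u"
  shows "runs (pour 1 (\<lambda>b. Push 0 b ;; Push 2 b ;; Push 2 True)) s (14 * Suc (length w))
    (s(1 := u, 0 := rev w @ s 0, 2 := mark (rev w) @ s 2))"
proof -
  have "runs (Push 0 b ;; Push 2 b ;; Push 2 True) s 6 (s(0 := b # s 0, 2 := True # b # s 2))" for b s
    by (rule runs_conv, (rule runs_Seq runs_Push)+) (simp_all add: fun_eq_iff)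
  then have "runs (pour 1 (\<lambda>b. Push 0 b ;; Push 2 b ;; Push 2 True)) s ((6 + 8) * Suc (length w))
      ((fold (\<lambda>b s. s(0 := b # s 0, 2 := True # b # s 2)) w s)(1 := u))"
    using assms by (intro runs_pour) (simp_all add: fun_eq_iff)
  then show ?thesis unfolding fold_push_both
    by (rule runs_conv) (simp_all add: fun_eq_iff)
qed

text \<open>Spelling out the three stacks in use gives intermediate stores a normal form, so that
  the rules for single programs chain by unification.\<close>

definition st :: "store \<Rightarrow> word \<Rightarrow> word \<Rightarrow> word \<Rightarrow> store" where
  "st s a b c = s(0 := a, 1 := b, 2 := c)"

lemma st_simps [simp]: "st s a b c 0 = a" "st s a b c 1 = b" "st s a b c (Suc 0) = b" "st s a b c 2 = c"
  by (simp_all add: st_def)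

lemma st_upd: "(st s a b c)(0 := x) = st s x b c" "(st s a b c)(1 := x) = st s a x c"
  "(st s a b c)(2 := x) = st s a b x"
  by (auto simp: st_def fun_eq_iff)

lemma runs_st: "runs d (st s (s 0) (s 1) (s 2)) t (st s a (s 1) (s 2)) \<Longrightarrow> runs d s t (s(0 := a))"
proof -
  have "st s (s 0) (s 1) (s 2) = s" "st s a (s 1) (s 2) = s(0 := a)"
    by (auto simp: st_def fun_eq_iff)
  then show "runs d (st s (s 0) (s 1) (s 2)) t (st s a (s 1) (s 2)) \<Longrightarrow> runs d s t (s(0 := a))"
    by simp
qed

lemma runs_Push_st:
  "runs (Push 0 x) (st s a b c) 2 (st s (x # a) b c)"
  "runs (Push 1 x) (st s a b c) 2 (st s a (x # b) c)"
  "runs (Push 2 x) (st s a b c) 2 (st s a b (x # c))"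
  using runs_Push[of 0 x "st s a b c"] runs_Push[of 1 x "st s a b c"] runs_Push[of 2 x "st s a b c"]
  by (simp_all add: st_upd del: One_nat_def)

lemma runs_pour_st:
  "runs (pour 1 (\<lambda>b. Skip)) (st s a (mark w @ False # u) c) (8 * Suc (length w)) (st s a u c)"
  "runs (pour 1 (\<lambda>b. Push 0 b)) (st s a (mark w @ False # u) c) (10 * Suc (length w)) (st s (rev w @ a) u c)"
  "runs (pour 1 (\<lambda>b. Push 0 b ;; Push 0 True)) (st s a (mark w @ False # u) c) (12 * Suc (length w))
    (st s (mark (rev w) @ a) u c)"
  "runs (pour 1 (\<lambda>b. Push 2 b ;; Push 2 True)) (st s a (mark w @ False # u) c) (12 * Suc (length w))
    (st s a u (mark (rev w) @ c))"
  "runs (pour 2 (\<lambda>b. Push 1 b ;; Push 1 True)) (st s a b (mark w @ False # u)) (12 * Suc (length w))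
    (st s a (mark (rev w) @ b) u)"
  "runs (pour 1 (\<lambda>b. Push 0 b ;; Push 2 b ;; Push 2 True)) (st s a (mark w @ False # u) c) (14 * Suc (length w))
    (st s (rev w @ a) u (mark (rev w) @ c))"
  using runs_pour_drop[of "st s a (mark w @ False # u) c" 1 w u]
    runs_pour_push[of "st s a (mark w @ False # u) c" 1 w u 0]
    runs_pour_mark[of "st s a (mark w @ False # u) c" 1 w u 0]
    runs_pour_mark[of "st s a (mark w @ False # u) c" 1 w u 2]
    runs_pour_mark[of "st s a b (mark w @ False # u)" 2 w u 1]
    runs_pour_both[of "st s a (mark w @ False # u) c" w u]
  by (simp_all add: st_upd del: One_nat_def)

lemma move_program:
  obtains d k where "\<And>(x::'a::enc) r s b c.
    runs d (st s (encode x @ r) b c) (k * Suc (sz x)) (st s r (mark (rev (encode x)) @ b) c)"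
proof -
  obtain d k where d: "\<And>(x::'a) r s. s 0 = encode x @ r \<Longrightarrow>
      runs d s (k * Suc (sz x)) (s(0 := r, 1 := mark (rev (encode x)) @ s 1))"
    using movable[where 'a = 'a] by blast
  have "runs d (st s (encode x @ r) b c) (k * Suc (sz x)) (st s r (mark (rev (encode x)) @ b) c)"
    for x :: 'a and r s b c
    using d[of "st s (encode x @ r) b c" x r] by (simp add: st_upd del: One_nat_def)
  then show thesis using that by blast
qed

text \<open>The first pour restores the value on stack 0 and leaves a marked copy on stack 2 in
  forward order. Pushing this copy back directly would reverse it, hence the detour through stack
  1.\<close>

lemma dup_program:
  "\<exists>c k. \<forall>(x::'a::enc) r s. s 0 = encode x @ r \<longrightarrow>
    runs c s (k * Suc (sz x)) (s(0 := encode x @ encode x @ r))"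
proof -
  obtain c k where c: "\<And>(x::'a) r s a b.
      runs c (st s (encode x @ r) a b) (k * Suc (sz x)) (st s r (mark (rev (encode x)) @ a) b)"
    using move_program[where 'a = 'a] by blast
  let ?c = "Push 1 False ;; c ;; Push 2 False ;; pour 1 (\<lambda>b. Push 0 b ;; Push 2 b ;; Push 2 True) ;;
    Push 1 False ;; pour 2 (\<lambda>b. Push 1 b ;; Push 1 True) ;; pour 1 (\<lambda>b. Push 0 b)"
  have "runs ?c s ((k + 100) * Suc (sz x)) (s(0 := encode x @ encode x @ r))"
    if "s 0 = encode x @ r" for x :: 'a and r s
    by (rule runs_st, unfold that, rule runs_conv, (rule runs_Seq runs_Push_st c runs_pour_st)+)
      (simp_all add: algebra_simps)
  then show ?thesis by blast
qed

text \<open>Both values are reversed onto stack 1, \<open>y\<close> above \<open>x\<close>. While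
  \<open>x\<close> returns, \<open>y\<close> waits on stack 2, again in forward order, and goes
  through stack 1 once more.\<close>

lemma swap_program:
  "\<exists>c k. \<forall>(x::'a::enc) (y::'b::enc) r s. s 0 = encode x @ encode y @ r \<longrightarrow>
    runs c s (k * Suc (sz x + sz y)) (s(0 := encode y @ encode x @ r))"
proof -
  obtain c k where c: "\<And>(x::'a) r s a b.
      runs c (st s (encode x @ r) a b) (k * Suc (sz x)) (st s r (mark (rev (encode x)) @ a) b)"
    using move_program[where 'a = 'a] by blast
  obtain d l where d: "\<And>(x::'b) r s a b.
      runs d (st s (encode x @ r) a b) (l * Suc (sz x)) (st s r (mark (rev (encode x)) @ a) b)"
    using move_program[where 'a = 'b] by blast
  let ?c = "Push 1 False ;; c ;; Push 1 False ;; d ;; Push 2 False ;;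
    pour 1 (\<lambda>b. Push 2 b ;; Push 2 True) ;; pour 1 (\<lambda>b. Push 0 b) ;;
    Push 1 False ;; pour 2 (\<lambda>b. Push 1 b ;; Push 1 True) ;; pour 1 (\<lambda>b. Push 0 b)"
  have "runs ?c s ((k + l + 100) * Suc (sz x + sz y)) (s(0 := encode y @ encode x @ r))"
    if "s 0 = encode x @ encode y @ r" for x :: 'a and y :: 'b and r s
    by (rule runs_st, unfold that, rule runs_conv, (rule runs_Seq runs_Push_st c d runs_pour_st)+)
      (simp_all add: algebra_simps)
  then show ?thesis by blast
qed

lemma drop_program:
  "\<exists>c k. \<forall>(x::'a::enc) r s. s 0 = encode x @ r \<longrightarrow> runs c s (k * Suc (sz x)) (s(0 := r))"
proof -
  obtain c k where c: "\<And>(x::'a) r s a b.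
      runs c (st s (encode x @ r) a b) (k * Suc (sz x)) (st s r (mark (rev (encode x)) @ a) b)"
    using move_program[where 'a = 'a] by blast
  have "runs (Push 1 False ;; c ;; pour 1 (\<lambda>b. Skip)) s ((k + 100) * Suc (sz x)) (s(0 := r))"
    if "s 0 = encode x @ r" for x :: 'a and r s
    by (rule runs_st, unfold that, rule runs_conv, (rule runs_Seq runs_Push_st c runs_pour_st)+)
      (simp_all add: algebra_simps)
  then show ?thesis by blast
qed

lemma pt_Pair:
  assumes "pt f" "pt g"
  shows "pt (\<lambda>x::'a::enc. (f x :: 'b::enc, g x :: 'c::enc))"
proof -
  obtain c h where c0: "computes c h (\<lambda>x. (f x))"
    and h: "poly_bdd h"
    using assms(1) by (rule ptE)
  note c = computesD[OF c0]
  obtain d k where d0: "computes d k (\<lambda>x. (g x))"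
    and k: "poly_bdd k"
    using assms(2) by (rule ptE)
  note d = computesD[OF d0]
  obtain dup m where dup: "\<And>(x::'a) r s. s 0 = encode x @ r \<Longrightarrow>
      runs dup s (m * Suc (sz x)) (s(0 := encode x @ encode x @ r))"
    using dup_program by blast
  obtain swap n where swap: "\<And>(x::'c) (y::'a) r s. s 0 = encode x @ encode y @ r \<Longrightarrow>
      runs swap s (n * Suc (sz x + sz y)) (s(0 := encode y @ encode x @ r))"
    using swap_program by blast
  show ?thesis
  proof (rule ptI)
    \<comment> \<open>The value of \<open>g\<close> is computed first because that of
      \<open>f\<close> has to end up on top.\<close>
    show "runs (dup ;; d ;; swap ;; c) s (m * Suc (sz x) + (k x + (n * Suc (sz (g x) + sz x) + h x)))
        (s(0 := encode (f x, g x) @ r))"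
      if "s 0 = encode x @ r" for x r s
      apply (rule runs_conv)
        apply (rule runs_Seq, rule dup[of s x r, OF that])
        apply (rule runs_Seq, rule d[of _ x "encode x @ r"], simp)
        apply (rule runs_Seq, rule swap[of _ "g x" x r], simp)
        apply (rule c[of _ x "encode (g x) @ r"], simp)
      by auto
    show "poly_bdd (\<lambda>x. m * Suc (sz x) + (k x + (n * Suc (sz (g x) + sz x) + h x)))"
      by (intro poly_bdd_intros h k assms)
  qed
qed

lemma pt_fst: "pt (fst :: 'a::enc \<times> 'b::enc \<Rightarrow> 'a)"
proof -
  obtain swap n where swap: "\<And>(x::'a) (y::'b) r s. s 0 = encode x @ encode y @ r \<Longrightarrow>
      runs swap s (n * Suc (sz x + sz y)) (s(0 := encode y @ encode x @ r))"
    using swap_program by blast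
  obtain drop k where drop: "\<And>(x::'b) r s. s 0 = encode x @ r \<Longrightarrow> runs drop s (k * Suc (sz x)) (s(0 := r))"
    using drop_program by blast
  show ?thesis
  proof (rule ptI)
    show "runs (swap ;; drop) s (n * Suc (sz p) + k * Suc (sz p)) (s(0 := encode (fst p) @ r))"
      if "s 0 = encode p @ r" for p :: "'a \<times> 'b" and r s
    proof (cases p)
      case (Pair x y)
      show ?thesis
        by (rule runs_conv, rule runs_Seq, rule swap[of _ x y r], simp add: that Pair,
          rule drop[of _ y "encode x @ r"], simp) (auto simp: Pair)
    qed
  qed (intro poly_bdd_intros)
qed

lemma pt_snd: "pt (snd :: 'a::enc \<times> 'b::enc \<Rightarrow> 'b)"
proof -
  obtain drop k where drop: "\<And>(x::'a) r s. s 0 = encode x @ r \<Longrightarrow> runs drop s (k * Suc (sz x)) (s(0 := r))"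
    using drop_program by blast
  show ?thesis
  proof (rule ptI)
    show "runs drop s (k * Suc (sz p)) (s(0 := encode (snd p) @ r))"
      if "s 0 = encode p @ r" for p :: "'a \<times> 'b" and r s
    proof (cases p)
      case (Pair x y)
      show ?thesis
        by (rule runs_conv, rule drop[of _ x "encode y @ r"], simp add: that Pair) (auto simp: Pair)
    qed
  qed (intro poly_bdd_intros)
qed

lemma runs_push_word:
  "\<exists>c k. \<forall>s. runs c s k (s(i := w @ s i))"
proof (induction w)
  case Nil
  have "\<forall>s. runs Skip s 0 (s(i := [] @ s i))" using runs_Skip by simp
  then show ?case by blast
next
  case (Cons b w)
  then obtain c k where "\<And>s. runs c s k (s(i := w @ s i))" by blast
  then have "runs (c ;; Push i b) s (k + 2) (s(i := (b # w) @ s i))" for s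
    by - (rule runs_conv, rule runs_Seq, assumption, rule runs_Push, auto)
  then show ?case by blast
qed

lemma pt_const: "pt (\<lambda>x::'a::enc. a)"
proof -
  obtain drop k where drop: "\<And>(x::'a) r s. s 0 = encode x @ r \<Longrightarrow> runs drop s (k * Suc (sz x)) (s(0 := r))"
    using drop_program by blast
  obtain c l where c: "\<And>s. runs c s l (s(0 := encode a @ s 0))"
    using runs_push_word by blast
  show ?thesis
  proof (rule ptI)
    show "runs (drop ;; c) s (k * Suc (sz x) + l) (s(0 := encode a @ r))"
      if "s 0 = encode x @ r" for x :: 'a and r s
      by (rule runs_conv, rule runs_Seq, rule drop[of s x r, OF that], rule c) auto
  qed (intro poly_bdd_intros)
qed

section \<open>Case distinctions, constructors and iteration\<close>

lemma pt_If:
  assumes "pt b" "pt f" "pt g"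
  shows "pt (\<lambda>x. if b x then f x else g x)"
proof -
  obtain p l where p0: "computes p l (\<lambda>x. (b x, x))"
    and l: "poly_bdd l"
    using pt_Pair[OF assms(1) pt_id] by (rule ptE)
  note p = computesD[OF p0]
  obtain c h where c0: "computes c h (\<lambda>x. (f x))"
    and h: "poly_bdd h"
    using assms(2) by (rule ptE)
  note c = computesD[OF c0]
  obtain d k where d0: "computes d k (\<lambda>x. (g x))"
    and k: "poly_bdd k"
    using assms(3) by (rule ptE)
  note d = computesD[OF d0]
  show ?thesis
  proof (rule ptI)
    show "runs (p ;; Cond 0 (\<lambda>b. b = Some True) (Pop 0 ;; c) (Pop 0 ;; d)) s (l x + (1 + (h x + k x) + 2))
        (s(0 := encode (if b x then f x else g x) @ r))"
      if "s 0 = encode x @ r" for x r s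
    proof (cases "b x")
      case True
      show ?thesis
        by (rule runs_conv, rule runs_Seq, rule p[of s x r, OF that], rule runs_CondT,
          simp add: encode_bool_def True, rule runs_Seq, rule runs_Pop, rule c[of _ x r])
          (auto simp: encode_bool_def True)
    next
      case False
      show ?thesis
        by (rule runs_conv, rule runs_Seq, rule p[of s x r, OF that], rule runs_CondF,
          simp add: encode_bool_def False, rule runs_Seq, rule runs_Pop, rule d[of _ x r])
          (auto simp: encode_bool_def False)
    qed
    show "poly_bdd (\<lambda>x. l x + (1 + (h x + k x) + 2))"
      by (intro poly_bdd_intros h k l)
  qed
qed

text \<open>The encoding of a nonempty list is that of the pair of head and tail behind a
  \<open>True\<close>, so a single push suffices. The constructors of \<open>arg\<close> work in the
  same way.\<close>

lemma pt_Cons: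
  assumes "pt f" "pt g"
  shows "pt (\<lambda>x. f x # g x)"
proof -
  have "pt (\<lambda>p :: 'b \<times> 'b list. fst p # snd p)"
    by (rule ptI[where c = "Push 0 True" and h = "\<lambda>_. 2"], rule runs_conv, rule runs_Push) (auto intro: poly_bdd_intros)
  from pt_comp[OF this pt_Pair[OF assms]] show ?thesis by simp
qed

lemma pt_Var:
  assumes "pt f"
  shows "pt (\<lambda>x. Var (f x))"
proof -
  have "pt Var"
    by (rule ptI[where c = "Push 0 True" and h = "\<lambda>_. 2"], rule runs_conv, rule runs_Push) (auto intro: poly_bdd_intros)
  from pt_comp[OF this assms] show ?thesis by simp
qed

lemma pt_Const:
  assumes "pt f"
  shows "pt (\<lambda>x. Const (f x))"
proof -
  have "pt Const"
    by (rule ptI[where c = "Push 0 False" and h = "\<lambda>_. 2"], rule runs_conv, rule runs_Push) (auto intro: poly_bdd_intros)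
  from pt_comp[OF this assms] show ?thesis by simp
qed

lemma pt_case_list:
  assumes "pt l" "pt f" and g: "pt (\<lambda>p. g (snd (snd p)) (fst p) (fst (snd p)))"
  shows "pt (\<lambda>x. case l x of [] \<Rightarrow> f x | a # as \<Rightarrow> g x a as)"
proof -
  obtain p l' where p0: "computes p l' (\<lambda>x. (l x, x))"
    and l': "poly_bdd l'"
    using pt_Pair[OF assms(1) pt_id] by (rule ptE)
  note p = computesD[OF p0]
  obtain c h where c0: "computes c h (\<lambda>x. (f x))"
    and h: "poly_bdd h"
    using assms(2) by (rule ptE)
  note c = computesD[OF c0]
  obtain d k where d0: "computes d k (\<lambda>x. (g (snd (snd x)) (fst x) (fst (snd x))))"
    and k: "poly_bdd k"
    using assms(3) by (rule ptE)
  note d = computesD[OF d0]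
  \<comment> \<open>The bound \<open>k\<close> takes the parts of \<open>l x\<close> as argument,
    which exist only if the list is nonempty. The polynomial \<open>q\<close> bounds it in terms of
    \<open>l x\<close> and \<open>x\<close>, which are always available.\<close>
  obtain q where q: "\<And>x. k x \<le> poly q (sz x)" using k unfolding poly_bdd_def by blast
  show ?thesis
  proof (rule ptI)
    show "runs (p ;; Cond 0 (\<lambda>b. b = Some True) (Pop 0 ;; d) (Pop 0 ;; c)) s
        (l' x + (1 + (h x + poly q (sz (l x, x))) + 2))
        (s(0 := encode (case l x of [] \<Rightarrow> f x | a # as \<Rightarrow> g x a as) @ r))"
      if "s 0 = encode x @ r" for x r s
    proof (cases "l x")
      case Nil
      show ?thesis
        by (rule runs_conv, rule runs_Seq, rule p[of s x r, OF that], rule runs_CondF,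
          simp add: Nil, rule runs_Seq, rule runs_Pop, rule c[of _ x r])
          (auto simp: Nil)
    next
      case (Cons a as)
      have "k (a, as, x) \<le> poly q (sz (l x, x))"
        by (rule order_trans[OF q poly_mono_nat]) (simp add: Cons)
      then show ?thesis
        by - (rule runs_conv, rule runs_Seq, rule p[of s x r, OF that], rule runs_CondT,
          simp add: Cons, rule runs_Seq, rule runs_Pop, rule d[of _ "(a, as, x)" r],
          auto simp: Cons)
    qed
    show "poly_bdd (\<lambda>x. l' x + (1 + (h x + poly q (sz (l x, x))) + 2))"
      by (intro poly_bdd_intros h l' pt_Pair assms(1) pt_id)
  qed
qed

lemma pt_case_arg:
  assumes "pt l" and f: "pt (\<lambda>p. f (snd p) (fst p))" and g: "pt (\<lambda>p. g (snd p) (fst p))"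
  shows "pt (\<lambda>x. case l x of Var v \<Rightarrow> f x v | Const b \<Rightarrow> g x b)"
proof -
  obtain p l' where p0: "computes p l' (\<lambda>x. (l x, x))"
    and l': "poly_bdd l'"
    using pt_Pair[OF assms(1) pt_id] by (rule ptE)
  note p = computesD[OF p0]
  obtain c h where c0: "computes c h (\<lambda>x. (f (snd x) (fst x)))"
    and h: "poly_bdd h"
    using f by (rule ptE)
  note c = computesD[OF c0]
  obtain d k where d0: "computes d k (\<lambda>x. (g (snd x) (fst x)))"
    and k: "poly_bdd k"
    using g by (rule ptE)
  note d = computesD[OF d0]
  obtain q where q: "\<And>x. k x \<le> poly q (sz x)" using k unfolding poly_bdd_def by blast
  obtain q' where q': "\<And>x. h x \<le> poly q' (sz x)" using h unfolding poly_bdd_def by blast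
  show ?thesis
  proof (rule ptI)
    show "runs (p ;; Cond 0 (\<lambda>b. b = Some True) (Pop 0 ;; c) (Pop 0 ;; d)) s
        (l' x + (1 + (poly q' (sz (l x, x)) + poly q (sz (l x, x))) + 2))
        (s(0 := encode (case l x of Var v \<Rightarrow> f x v | Const b \<Rightarrow> g x b) @ r))"
      if "s 0 = encode x @ r" for x r s
    proof (cases "l x")
      case (Var v)
      have "h (v, x) \<le> poly q' (sz (l x, x))"
        by (rule order_trans[OF q' poly_mono_nat]) (simp add: Var)
      then show ?thesis
        by - (rule runs_conv, rule runs_Seq, rule p[of s x r, OF that], rule runs_CondT,
          simp add: Var, rule runs_Seq, rule runs_Pop, rule c[of _ "(v, x)" r],
          auto simp: Var)
    next
      case (Const b)
      have "k (b, x) \<le> poly q (sz (l x, x))"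
        by (rule order_trans[OF q poly_mono_nat]) (simp add: Const)
      then show ?thesis
        by - (rule runs_conv, rule runs_Seq, rule p[of s x r, OF that], rule runs_CondF,
          simp add: Const, rule runs_Seq, rule runs_Pop, rule d[of _ "(b, x)" r],
          auto simp: Const)
    qed
    show "poly_bdd (\<lambda>x. l' x + (1 + (poly q' (sz (l x, x)) + poly q (sz (l x, x))) + 2))"
      by (intro poly_bdd_intros l' pt_Pair assms(1) pt_id)
  qed
qed

lemma encode_word: "encode (w :: word) = mark w @ [False]"
  by (induction w) (auto simp: encode_bool_def)

text \<open>A marked word followed by \<open>False\<close> is itself the encoding of that word.
  Encoding a value once more thus amounts to keeping the marks when it is poured back.\<close>

lemma pt_encode: "pt (encode :: 'a::enc \<Rightarrow> word)"
proof -
  obtain c k where c: "\<And>(x::'a) r s a b.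
      runs c (st s (encode x @ r) a b) (k * Suc (sz x)) (st s r (mark (rev (encode x)) @ a) b)"
    using move_program[where 'a = 'a] by blast
  show ?thesis
  proof (rule ptI)
    show "runs (Push 1 False ;; c ;; Push 0 False ;; pour 1 (\<lambda>b. Push 0 b ;; Push 0 True)) s
        ((k + 100) * Suc (sz x)) (s(0 := encode (encode x) @ r))"
      if "s 0 = encode x @ r" for x :: 'a and r s
      by (rule runs_st, unfold that, rule runs_conv, (rule runs_Seq runs_Push_st c runs_pour_st)+)
        (simp_all add: algebra_simps encode_word)
  qed (intro poly_bdd_intros)
qed

text \<open>A step that doubles its accumulator reaches exponential size after linearly many rounds;
  therefore every partial result is required to stay below \<open>B\<close>.\<close>

lemma pt_fold:
  fixes l :: "'a::enc \<Rightarrow> 'b::enc list" and i :: "'a \<Rightarrow> 'c::enc"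
  assumes l: "pt l" and i: "pt i" and g: "pt (\<lambda>p. g (snd (snd p)) (fst p) (fst (snd p)))"
    and B: "poly_bdd B"
    and bound: "\<And>x ys zs. l x = ys @ zs \<Longrightarrow> sz (fold (g x) ys (i x)) \<le> B x"
  shows "pt (\<lambda>x. fold (g x) (l x) (i x))"
proof -
  have 1: "pt (\<lambda>x. (l x, i x, x))"
    by (intro pt_Pair l i pt_id)
  have "pt (\<lambda>p :: 'b \<times> 'b list \<times> 'c \<times> 'a.
      (fst (snd p), g (snd (snd (snd p))) (fst p) (fst (snd (snd p))), snd (snd (snd p))))"
    by (intro pt_Pair pt_comp[OF pt_fst] pt_comp[OF pt_snd] pt_id pt_fst pt_snd
      pt_comp[OF g, of "\<lambda>p. (fst p, fst (snd (snd p)), snd (snd (snd p)))", simplified])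
  then obtain c h where c0: "computes c h
      (\<lambda>p :: 'b \<times> 'b list \<times> 'c \<times> 'a.
        (fst (snd p), g (snd (snd (snd p))) (fst p) (fst (snd (snd p))), snd (snd (snd p))))"
    and h: "poly_bdd h"
    by (rule ptE)
  have c: "runs c s (h (a, as, acc, x)) (s(0 := encode (as, g x a acc, x) @ r))"
    if "s 0 = encode (a, as, acc, x) @ r" for a as acc x r s
    using computesD[OF c0, of s "(a, as, acc, x)" r] that by simp
  obtain q where q: "\<And>x. h x \<le> poly q (sz x)" using h unfolding poly_bdd_def by blast
  \<comment> \<open>This bounds every round. The remaining list, the accumulator and
    \<open>x\<close> lie on stack 0 in this order; popping the \<open>True\<close> of the list turns
    them into the argument of \<open>c\<close>, and after \<open>c\<close> the first bit of the
    shorter list decides about the next round.\<close>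
  let ?T = "\<lambda>x. poly q (sz (l x) + (B x + sz x))"
  let ?c = "Loop 0 (\<lambda>b. b = Some True) (Pop 0 ;; c)"
  have loop: "runs ?c s (length zs * (?T x + 3) + 1) (s(0 := False # encode (fold (g x) (l x) (i x), x) @ r))"
    if "s 0 = encode (zs, fold (g x) ys (i x), x) @ r" "l x = ys @ zs" for x ys zs r s
    using that
  proof (induction zs arbitrary: ys s)
    case Nil
    then show ?case by - (rule runs_conv, rule runs_LoopF, auto)
  next
    case (Cons a zs)
    let ?acc = "fold (g x) ys (i x)"
    have sz_app: "sz (us @ vs) + 1 = sz us + sz vs" for us vs :: "'b list"
      by (induction us) auto
    have "sz ?acc \<le> B x" using bound Cons.prems(2) by blast
    moreover have "sz a + sz zs \<le> sz (l x)" using sz_app[of ys "a # zs"] Cons.prems(2)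
      by simp
    ultimately have t: "h (a, zs, ?acc, x) \<le> ?T x"
      by (intro order_trans[OF q poly_mono_nat]) simp
    show ?case
      apply (rule runs_conv)
        apply (rule runs_LoopT, simp add: Cons.prems)
         apply (rule runs_Seq, rule runs_Pop)
         apply (rule c[of _ a zs ?acc x r], simp add: Cons.prems)
        apply (rule Cons.IH[of _ "ys @ [a]"], simp, simp add: Cons.prems)
      using t by auto
  qed
  have 2: "pt (\<lambda>x. (fold (g x) (l x) (i x), x))"
  proof -
    obtain d k where d0: "computes d k (\<lambda>x. (l x, i x, x))"
      and k: "poly_bdd k"
      using 1 by (rule ptE)
    note d = computesD[OF d0]
    show ?thesis
    proof (rule ptI)
      show "runs (d ;; ?c ;; Pop 0) s (k x + (sz (l x) * (?T x + 3) + 1 + 1))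
          (s(0 := encode (fold (g x) (l x) (i x), x) @ r))"
        if "s 0 = encode x @ r" for x r s
        apply (rule runs_conv)
          apply (rule runs_Seq, rule d[of s x r, OF that])
          apply (rule runs_Seq, rule loop[where zs = "l x" and ys = "[]" and r = r], simp, simp)
          apply (rule runs_Pop)
        by (auto intro: less_imp_le)
      show "poly_bdd (\<lambda>x. k x + (sz (l x) * (?T x + 3) + 1 + 1))"
        by (intro poly_bdd_intros k B l)
    qed
  qed
  show ?thesis using pt_comp[OF pt_fst 2] by simp
qed


section \<open>Closure properties of polynomial time\<close>

lemmas pt_fstI = pt_comp[OF pt_fst]
lemmas pt_sndI = pt_comp[OF pt_snd]
lemmas pt_intros = pt_id pt_const pt_fstI pt_sndI pt_Pair pt_If pt_Cons pt_Var pt_Const pt_case_list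
  pt_case_arg pt_comp[OF pt_encode]

lemma pt_cong: "pt f \<Longrightarrow> (\<And>x. f x = g x) \<Longrightarrow> pt g"
  by (metis ext)

lemma pt_Not: "pt P \<Longrightarrow> pt (\<lambda>x. \<not> P x)"
  by (rule pt_cong[OF pt_If[of P "\<lambda>_. False" "\<lambda>_. True"]]) (auto intro: pt_const)

lemma pt_conj: "pt P \<Longrightarrow> pt Q \<Longrightarrow> pt (\<lambda>x. P x \<and> Q x)"
  by (rule pt_cong[OF pt_If[of P Q "\<lambda>_. False"]]) (auto intro: pt_const)

lemma pt_imp: "pt P \<Longrightarrow> pt Q \<Longrightarrow> pt (\<lambda>x. P x \<longrightarrow> Q x)"
  using pt_Not[OF pt_conj[OF _ pt_Not]] by simp

lemma pt_iff: "pt P \<Longrightarrow> pt Q \<Longrightarrow> pt (\<lambda>x. P x \<longleftrightarrow> Q x)"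
  by (rule pt_cong[OF pt_If[OF _ _ pt_Not, of P Q Q]]) auto

lemma sz_bool [simp]: "sz (b :: bool) = 1"
  by (simp add: encode_bool_def)

lemma sz_word: "sz w = 2 * length w + 1" for w :: word
  by (induction w) auto

lemma sz_append: "sz (xs @ ys) + 1 = sz xs + sz ys" for xs ys :: "'a::enc list"
  by (induction xs) auto

lemma sz_member: "a \<in> set xs \<Longrightarrow> sz a \<le> sz xs" for xs :: "'a::enc list"
  by (induction xs) auto

text \<open>Additive growth is harmless: after any number of rounds the accumulator has gained at
  most the length of the list times \<open>B x\<close>. The invariant restricts the growth condition
  to accumulators that can occur.\<close>

lemma pt_fold_inv:
  fixes l :: "'a::enc \<Rightarrow> 'b::enc list" and i :: "'a \<Rightarrow> 'c::enc"
  assumes "pt l" "pt i" "pt (\<lambda>p. g (snd (snd p)) (fst p) (fst (snd p)))"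
    and B: "poly_bdd B"
    and I: "\<And>x. I x (i x)"
    and step: "\<And>x a acc. a \<in> set (l x) \<Longrightarrow> I x acc \<Longrightarrow> I x (g x a acc) \<and> sz (g x a acc) \<le> sz acc + B x"
  shows "pt (\<lambda>x. fold (g x) (l x) (i x))"
proof (rule pt_fold[OF assms(1-3)])
  have "I x (fold (g x) ys (i x)) \<and> sz (fold (g x) ys (i x)) \<le> sz (i x) + length ys * B x"
    if "set ys \<subseteq> set (l x)" for x ys
    using that
  proof (induction ys rule: rev_induct)
    case (snoc y ys)
    then show ?case using step[of y x "fold (g x) ys (i x)"] by auto
  qed (simp add: I)
  moreover have "length ys * B x \<le> sz (l x) * B x" if "l x = ys @ zs" for x ys zs
    using that sz_list_ge[of "l x"] by (intro mult_right_mono) auto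
  ultimately show "sz (fold (g x) ys (i x)) \<le> sz (i x) + sz (l x) * B x" if "l x = ys @ zs" for x ys zs
    using that by (metis Un_upper1 add_left_mono le_trans set_append)
qed (intro poly_bdd_intros assms)

lemma pt_drop_mid: "pt (\<lambda>p. (fst p, snd (snd p)))"
  by (intro pt_intros)

section \<open>Bounded quantifiers, list functions and equality\<close>

lemma pt_ball:
  assumes "pt l" "pt (\<lambda>p. P (snd p) (fst p))"
  shows "pt (\<lambda>x. \<forall>a\<in>set (l x). P x a)"
proof -
  have "fold (\<lambda>a acc. acc \<and> P x a) xs b \<longleftrightarrow> b \<and> (\<forall>a\<in>set xs. P x a)" for x xs b
    by (induction xs arbitrary: b) auto
  moreover have "pt (\<lambda>x. fold (\<lambda>a acc. acc \<and> P x a) (l x) True)"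
    using pt_comp[OF assms(2), of "\<lambda>p. (fst p, snd (snd p))", OF pt_drop_mid]
    by (intro pt_fold_inv[where B = "\<lambda>_. 1" and I = "\<lambda>_ _. True"] assms(1) pt_conj pt_intros poly_bdd_const)
      (auto intro!: pt_intros)
  ultimately show ?thesis by simp
qed

lemma pt_bex:
  assumes "pt l" "pt (\<lambda>p. P (snd p) (fst p))"
  shows "pt (\<lambda>x. \<exists>a\<in>set (l x). P x a)"
  using pt_Not[OF pt_ball[OF assms(1) pt_Not[OF assms(2)]]] by simp

lemma pt_rev:
  assumes "pt l"
  shows "pt (\<lambda>x. rev (l x))"
proof -
  have "pt (\<lambda>x. fold Cons (l x) [])"
    using assms sz_member
    by (intro pt_fold_inv[where B = "\<lambda>x. 1 + sz (l x)" and I = "\<lambda>_ _. True"] pt_intros poly_bdd_intros) auto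
  then show ?thesis by (simp add: fold_Cons_rev)
qed

lemma pt_append:
  assumes "pt l" "pt m"
  shows "pt (\<lambda>x. l x @ m x)"
proof -
  have "pt (\<lambda>x. fold Cons (rev (l x)) (m x))"
    using assms sz_member[of _ "l _"]
    by (intro pt_fold_inv[where B = "\<lambda>x. 1 + sz (l x)" and I = "\<lambda>_ _. True"] pt_intros poly_bdd_intros pt_rev) auto
  then show ?thesis by (simp add: fold_Cons_rev)
qed

lemma pt_map:
  assumes "pt l" "pt (\<lambda>p. f (snd p) (fst p))"
  shows "pt (\<lambda>x. map (f x) (l x))"
proof -
  obtain q where "\<forall>p. sz (f (snd p) (fst p)) \<le> poly q (sz p)"
    using poly_bdd_pt[OF assms(2)] unfolding poly_bdd_def by blast
  then have q: "sz (f x a) \<le> poly q (sz a + sz x)" for x a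
    by (metis encode_prod.simps fst_conv length_append snd_conv)
  have B: "sz (f x a) \<le> poly q (sz (l x) + sz x)" if "a \<in> set (l x)" for x a
    using order_trans[OF q poly_mono_nat] sz_member[OF that] by (simp add: add_right_mono)
  have "fold (\<lambda>a acc. f x a # acc) xs acc = rev (map (f x) xs) @ acc" for x xs acc
    by (induction xs arbitrary: acc) auto
  moreover have "pt (\<lambda>x. rev (fold (\<lambda>a acc. f x a # acc) (l x) []))"
    using assms(1) pt_comp[OF assms(2), of "\<lambda>p. (fst p, snd (snd p))", OF pt_drop_mid] B
    by (intro pt_fold_inv[where B = "\<lambda>x. 1 + poly q (sz (l x) + sz x)" and I = "\<lambda>_ _. True"]
        pt_Cons pt_intros poly_bdd_intros pt_rev)
      (auto intro!: pt_intros)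
  ultimately show ?thesis by simp
qed

lemma pt_concat:
  assumes "pt l"
  shows "pt (\<lambda>x. concat (l x))"
proof -
  have "fold (\<lambda>a acc. acc @ a) xs acc = acc @ concat xs" for xs :: "'b list list" and acc
    by (induction xs arbitrary: acc) auto
  moreover have "sz (acc @ a) \<le> sz acc + sz (l x)" if "a \<in> set (l x)" for a acc x
    using sz_append[of acc a] sz_member[OF that] by simp
  then have "pt (\<lambda>x. fold (\<lambda>a acc. acc @ a) (l x) [])"
    using assms
    by (intro pt_fold_inv[where B = "\<lambda>x. sz (l x)" and I = "\<lambda>_ _. True"]
        pt_intros poly_bdd_intros pt_append) auto
  ultimately show ?thesis by simp
qed

text \<open>Encodings are injective, so equality at every type reduces to comparing two words bit by
  bit.\<close>

lemma pt_eq: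
  assumes "pt f" "pt g"
  shows "pt (\<lambda>x. f x = g x)"
proof -
  \<comment> \<open>The state is the unread part of the second word and whether all bits agreed so
    far. A second word that ends too early clears the flag; one that is too long is noticed by a
    nonempty rest.\<close>
  define cmp where "cmp = (\<lambda>b st. case fst st of [] \<Rightarrow> ([], False) | c # cs \<Rightarrow> (cs, snd st \<and> (b \<longleftrightarrow> c)))"
  have cmp: "snd (fold cmp v (w, ok)) \<and> fst (fold cmp v (w, ok)) = [] \<longleftrightarrow> ok \<and> v = w" for v w ok
  proof (induction v arbitrary: w ok)
    case (Cons b v)
    show ?case by (cases w) (use Cons in \<open>auto simp: cmp_def\<close>)
  qed auto
  have Nil: "(case w of [] \<Rightarrow> True | _ # _ \<Rightarrow> False) \<longleftrightarrow> w = []" for w :: word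
    by (cases w) auto
  have "pt (\<lambda>x. fold cmp (encode (f x)) (encode (g x), True))"
    by (intro pt_fold_inv[where B = "\<lambda>x. 1" and I = "\<lambda>_ _. True"])
      (auto simp: cmp_def encode_bool_def split: list.split intro!: poly_bdd_const pt_intros assms pt_conj pt_iff)
  from pt_conj[OF pt_sndI[OF this] pt_case_list[OF pt_fstI[OF this] pt_const[of True] pt_const[of False]]]
  show ?thesis by (simp add: Nil cmp)
qed

lemma pt_member:
  assumes "pt f" "pt l"
  shows "pt (\<lambda>x. f x \<in> set (l x))"
proof -
  have "pt (\<lambda>x. \<exists>a\<in>set (l x). a = f x)"
    by (intro pt_bex assms pt_eq pt_intros pt_comp[OF assms(1)])
  moreover have "(\<exists>a\<in>set (l x). a = f x) \<longleftrightarrow> f x \<in> set (l x)" for x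
    by blast
  ultimately show ?thesis by simp
qed

lemma pt_tl:
  assumes "pt l"
  shows "pt (\<lambda>x. tl (l x))"
proof -
  have "pt (\<lambda>x. case l x of [] \<Rightarrow> [] | a # as \<Rightarrow> as)"
    by (intro pt_intros assms)
  then show ?thesis by (simp add: tl_def)
qed

lemma sz_tl: "sz (tl xs) \<le> sz xs" for xs :: "'a::enc list"
  by (cases xs) auto

lemma pt_length_le:
  assumes "pt l" "pt m"
  shows "pt (\<lambda>x. length (l x) \<le> length (m x))"
proof -
  have "fold (\<lambda>_. tl) ys xs = drop (length ys) xs" for ys :: "'c list" and xs :: "'b list"
    by (induction ys arbitrary: xs) (auto simp: drop_Suc)
  moreover have "pt (\<lambda>x. fold (\<lambda>_. tl) (m x) (l x) = [])"
    by (intro pt_eq pt_fold_inv[where B = "\<lambda>x. 0" and I = "\<lambda>_ _. True"])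
      (auto intro!: pt_intros assms pt_tl poly_bdd_const simp: sz_tl)
  ultimately show ?thesis by simp
qed

text \<open>These are the nonempty suffixes. They serve twice: distinctness becomes a quantifier
  over a list, and the suffixes of \<open>L\<close> marks enumerate the unary numbers from 1 to
  \<open>L\<close>.\<close>

definition tails :: "'a list \<Rightarrow> 'a list list" where
  "tails xs = snd (fold (\<lambda>_ st. (tl (fst st), fst st # snd st)) xs (xs, []))"

lemma set_tails: "set (tails xs) = (\<lambda>i. drop i xs) ` {..<length xs}"
proof -
  have "fold (\<lambda>_ st. (tl (fst st), fst st # snd st)) ys (zs, acc) =
      (drop (length ys) zs, rev (map (\<lambda>i. drop i zs) [0..<length ys]) @ acc)"
    for ys zs :: "'a list" and acc
    by (induction ys rule: rev_induct) (auto simp: drop_Suc tl_drop)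
  then show ?thesis unfolding tails_def by (auto simp: lessThan_atLeast0)
qed

lemma pt_tails:
  assumes "pt l"
  shows "pt (\<lambda>x. tails (l x))"
  unfolding tails_def
proof (intro pt_sndI pt_fold_inv[where B = "\<lambda>x. 1 + sz (l x)" and I = "\<lambda>x st. sz (fst st) \<le> sz (l x)"])
  fix x a and st :: "'b list \<times> 'b list list"
  assume "sz (fst st) \<le> sz (l x)"
  then show "sz (fst (tl (fst st), fst st # snd st)) \<le> sz (l x) \<and>
      sz (tl (fst st), fst st # snd st) \<le> sz st + (1 + sz (l x))"
    using sz_tl[of "fst st"] by (cases st) auto
qed (auto intro!: pt_intros assms poly_bdd_intros pt_tl)

lemma distinct_tails: "distinct xs \<longleftrightarrow> (\<forall>t\<in>set (tails xs). case t of [] \<Rightarrow> True | a # t' \<Rightarrow> a \<notin> set t')"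
proof -
  have "distinct xs \<longleftrightarrow> (\<forall>i<length xs. case drop i xs of [] \<Rightarrow> True | a # t' \<Rightarrow> a \<notin> set t')"
  proof (induction xs)
    case (Cons a xs)
    then show ?case by (simp add: All_less_Suc2)
  qed simp
  then show ?thesis by (auto simp: set_tails)
qed

lemma pt_distinct:
  assumes "pt l"
  shows "pt (\<lambda>x. distinct (l x))"
  unfolding distinct_tails
  by (intro pt_ball pt_tails assms pt_intros pt_Not pt_member)

text \<open>Numbers are written in unary, and the induction over \<open>p\<close> is Horner's
  scheme: multiplication by the length of \<open>l x\<close> concatenates one copy for each of its
  elements.\<close>

lemma pt_replicate_poly:
  fixes l :: "'a::enc \<Rightarrow> 'b::enc list"
  assumes "pt l"
  shows "pt (\<lambda>x. replicate (poly p (length (l x))) True)"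
proof (induction p)
  case 0
  show ?case by (simp add: pt_const)
next
  case (pCons a p)
  have "concat (map (\<lambda>_. replicate n b) xs) = replicate (length xs * n) b" for n and b :: bool and xs :: "'b list"
    by (induction xs) (auto simp: replicate_add)
  moreover have "pt (\<lambda>x. replicate a True @ concat (map (\<lambda>_. replicate (poly p (length (l x))) True) (l x)))"
    by (intro pt_append pt_concat pt_map assms pt_const pt_comp[OF pCons.IH] pt_snd)
  ultimately show ?case by (simp add: replicate_add)
qed

section \<open>Parsing, and the passage from words to encoded values\<close>

lemma pt_parse_bool: "pt (parse :: word \<Rightarrow> bool \<times> word)"
  unfolding parse_bool_def[abs_def] by (intro pt_intros)

lemma pt_parse_prod:
  assumes "pt (parse :: word \<Rightarrow> 'a::enc \<times> word)" "pt (parse :: word \<Rightarrow> 'b::enc \<times> word)"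
  shows "pt (parse :: word \<Rightarrow> ('a \<times> 'b) \<times> word)"
  unfolding parse_prod_def[abs_def] Let_def case_prod_unfold
  by (intro pt_intros assms pt_comp[OF assms(1)] pt_comp[OF assms(2)])

text \<open>Even on malformed input the rest never gets longer, by \<open>length_parse\<close>. So
  each item is parsed from a word no longer than \<open>z\<close>, and its size is bounded by a
  fixed polynomial in \<open>sz z\<close>.\<close>

lemma pt_parse_list:
  assumes "pt (parse :: word \<Rightarrow> 'a::enc \<times> word)"
  shows "pt (parse :: word \<Rightarrow> 'a list \<times> word)"
proof -
  obtain q where q: "\<And>w. sz (parse w :: 'a \<times> word) \<le> poly q (sz w)"
    using poly_bdd_pt[OF assms] unfolding poly_bdd_def by blast
  define I where "I = (\<lambda>z (st :: 'a list \<times> word \<times> bool). sz (fst (snd st)) \<le> sz (z :: word))"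
  have step: "I z (parse_item st) \<and> sz (parse_item st) \<le> sz st + (1 + poly q (sz z))" if "I z st" for z st
  proof -
    obtain acc w f where st: "st = (acc, w, f)" by (cases st)
    consider "f" | "w = []" "\<not> f" | w' where "w = False # w'" "\<not> f" | w' where "w = True # w'" "\<not> f"
      by (cases w) (metis (full_types) list.exhaust)+
    then show ?thesis
    proof cases
      case 1
      then show ?thesis using that st by simp
    next
      case 2
      then show ?thesis using that st by (simp add: parse_item_def I_def)
    next
      case 3
      then show ?thesis using that st by (simp add: I_def)
    next
      case 4
      let ?p = "parse w' :: 'a \<times> word"
      have "sz (snd ?p) \<le> sz w'"
        using length_parse[of w', where 'a = 'a] by (simp add: sz_word)
      moreover have "sz (fst ?p) \<le> poly q (sz z)"
      proof -
        have "sz (fst ?p) \<le> sz ?p" by (cases ?p) simp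
        also have "\<dots> \<le> poly q (sz w')" by (rule q)
        also have "\<dots> \<le> poly q (sz z)" using that st 4 by (intro poly_mono_nat) (simp add: I_def)
        finally show ?thesis .
      qed
      ultimately show ?thesis using that st 4 by (simp add: I_def Let_def)
    qed
  qed
  have item: "pt (parse_item :: 'a list \<times> word \<times> bool \<Rightarrow> _)"
    unfolding parse_item_def[abs_def] Let_def
    by (intro pt_intros pt_comp[OF assms])
  have "pt (\<lambda>z. fold (\<lambda>_. parse_item) z ([] :: 'a list, z, False))"
    by (intro pt_fold_inv[where B = "\<lambda>z. 1 + poly q (sz z)" and I = I] pt_intros pt_comp[OF item] poly_bdd_intros)
      (use step in \<open>auto simp: I_def\<close>)
  then show ?thesis
    unfolding parse_list_def[abs_def] Let_def by (intro pt_intros pt_rev)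
qed

lemma pt_parse_arg: "pt (parse :: word \<Rightarrow> arg \<times> word)"
  unfolding parse_arg_def[abs_def] Let_def
  by (intro pt_intros pt_comp[OF pt_parse_bool] pt_comp[OF pt_parse_list[OF pt_parse_bool]])

text \<open>The input of a machine is delimited by blanks only, so this program, unlike all others,
  tests for an empty stack. The word goes reversed to stack 1 and returns with marks, above a
  \<open>False\<close>.\<close>

lemma input_program:
  "\<exists>c. \<forall>x. runs c ((\<lambda>_. [])(0 := x)) (20 * length x + 10) ((\<lambda>_. [])(0 := encode (x :: word)))"
proof -
  let ?c1 = "Loop 0 (\<lambda>b. b \<noteq> None) (Cond 0 (\<lambda>b. b = Some True) (Pop 0 ;; Push 1 True) (Pop 0 ;; Push 1 False))"
  let ?c2 = "Loop 1 (\<lambda>b. b \<noteq> None) (Cond 1 (\<lambda>b. b = Some True)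
    (Pop 1 ;; Push 0 True ;; Push 0 True) (Pop 1 ;; Push 0 False ;; Push 0 True))"
  have 1: "runs ?c1 (st s x y []) (10 * length x + 1) (st s [] (rev x @ y) [])" for s x y
  proof (induction x arbitrary: y)
    case Nil
    show ?case by (rule runs_conv, rule runs_LoopF) auto
  next
    case (Cons b x)
    have "runs (Cond 0 (\<lambda>b. b = Some True) (Pop 0 ;; Push 1 True) (Pop 0 ;; Push 1 False))
        (st s (b # x) y []) 5 (st s x (b # y) [])"
    proof (cases b)
      case True
      show ?thesis by (rule runs_conv, rule runs_CondT, simp add: True, rule runs_Seq, rule runs_Pop, rule runs_Push)
          (simp_all add: True st_upd del: One_nat_def)
    next
      case False
      show ?thesis by (rule runs_conv, rule runs_CondF, simp add: False, rule runs_Seq, rule runs_Pop, rule runs_Push)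
          (simp_all add: False st_upd del: One_nat_def)
    qed
    then show ?case
      by - (rule runs_conv, rule runs_LoopT[OF _ _ Cons.IH], auto)
  qed
  have 2: "runs ?c2 (st s y x []) (10 * length x + 1) (st s (mark (rev x) @ y) [] [])" for s x y
  proof (induction x arbitrary: y)
    case Nil
    show ?case by (rule runs_conv, rule runs_LoopF) auto
  next
    case (Cons b x)
    have "runs (Cond 1 (\<lambda>b. b = Some True) (Pop 1 ;; Push 0 True ;; Push 0 True) (Pop 1 ;; Push 0 False ;; Push 0 True))
        (st s y (b # x) []) 7 (st s (True # b # y) x [])"
    proof (cases b)
      case True
      show ?thesis by (rule runs_conv, rule runs_CondT, simp add: True, (rule runs_Seq runs_Pop runs_Push)+)
          (simp_all add: True st_upd del: One_nat_def)
    next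
      case False
      show ?thesis by (rule runs_conv, rule runs_CondF, simp add: False, (rule runs_Seq runs_Pop runs_Push)+)
          (simp_all add: False st_upd del: One_nat_def)
    qed
    then show ?case
      by - (rule runs_conv, rule runs_LoopT[OF _ _ Cons.IH], auto)
  qed
  have init: "(\<lambda>_. [])(0 := x) = st (\<lambda>_. []) x [] []" for x
    by (auto simp: st_def fun_eq_iff)
  have "runs (?c1 ;; Push 0 False ;; ?c2) ((\<lambda>_. [])(0 := x)) (20 * length x + 10) ((\<lambda>_. [])(0 := encode (x :: word)))" for x
    unfolding init by (rule runs_conv, rule runs_Seq, rule 1, rule runs_Seq, rule runs_Push_st, rule 2)
      (auto simp: encode_word)
  then show ?thesis by blast
qed

lemma poly_time_computable_pt:
  fixes f :: "word \<Rightarrow> 'a::enc"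
  assumes "pt f"
  shows "poly_time_computable (\<lambda>x. encode (f x))"
proof -
  obtain i where i: "\<And>x. runs i ((\<lambda>_. [])(0 := x)) (20 * length x + 10) ((\<lambda>_. [])(0 := encode x))"
    using input_program by blast
  obtain c h where c: "computes c h f" and h: "poly_bdd h"
    using assms by (rule ptE)
  obtain q where q: "\<And>x. h x \<le> poly q (sz x)" using h unfolding poly_bdd_def by blast
  \<comment> \<open>The first summand pays for converting the input; in the second,
    \<open>[:1, 2:]\<close> is the size of the encoding of a word of given length.\<close>
  let ?q = "[:10, 20:] + pcompose q [:1, 2:]"
  let ?M = "machine (width (i ;; c)) (compile (i ;; c) 0)"
  have "computes_within ?M x (encode (f x)) (poly ?q (length x))" for x
  proof -
    have "runs (i ;; c) ((\<lambda>_. [])(0 := x)) (poly ?q (length x)) ((\<lambda>_. [])(0 := encode (f x)))"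
      by (rule runs_conv, rule runs_Seq, rule i, rule computesD[OF c, of _ x "[]"])
        (use q[of x] in \<open>auto simp: poly_pcompose sz_word mult.commute\<close>)
    then show ?thesis
      unfolding runs_def using computes_within_exec by (metis fun_upd_same)
  qed
  moreover have "width c \<ge> 1" for c by (induction c) auto
  then have "turing_machine ?M" by (rule turing_machine_machine)
  ultimately show ?thesis unfolding poly_time_computable_def by blast
qed

lemma class_P_pt: "pt P \<Longrightarrow> {x. P x} \<in> class_P"
  using poly_time_computable_pt[of P] by (simp add: class_P_def encode_bool_def)


section \<open>Falsifiable constraint applications and their certificates\<close>

text \<open>The truth table stands for the constraint, whose function has no encoding. Below,
  \<open>ar\<close> lists each truth table with its arity in unary, \<open>tr\<close> lists each
  truth table with its satisfying rows, and \<open>cst\<close> tells whether constants may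
  occur.\<close>

type_synonym app = "word \<times> arg list"

definition well_formed :: "(word \<times> word) list \<Rightarrow> bool \<Rightarrow> word list \<Rightarrow> app \<Rightarrow> bool" where
  "well_formed ar cst xs a \<longleftrightarrow> (fst a, map (\<lambda>_. False) (snd a)) \<in> set ar \<and>
     (\<forall>r\<in>set (snd a). case r of Var v \<Rightarrow> v \<in> set xs | Const b \<Rightarrow> cst)"

definition app_sat :: "(word \<times> word) list \<Rightarrow> (word \<Rightarrow> bool) \<Rightarrow> app \<Rightarrow> bool" where
  "app_sat tr \<sigma> a \<longleftrightarrow> (fst a, map (arg_val \<sigma>) (snd a)) \<in> set tr"

definition app_rename :: "(word \<Rightarrow> word) \<Rightarrow> app \<Rightarrow> app" where
  "app_rename \<pi> a = (fst a, map (rename_arg \<pi>) (snd a))"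

definition falsifiable :: "(word \<times> word) list \<Rightarrow> (word \<times> word) list \<Rightarrow> word list \<Rightarrow> app list \<Rightarrow> app set" where
  "falsifiable ar tr xs ss =
     {a. well_formed ar True xs a \<and> (\<exists>\<sigma>. (\<forall>s\<in>set ss. app_sat tr \<sigma> s) \<and> \<not> app_sat tr \<sigma> a)}"

definition app_isomorphic :: "(word \<times> word) list \<Rightarrow> word list \<Rightarrow> app list \<Rightarrow> app list \<Rightarrow> bool" where
  "app_isomorphic tr xs ss us \<longleftrightarrow> (\<exists>\<pi>. \<pi> permutes set xs \<and>
     (\<forall>\<sigma>. (\<forall>s\<in>set ss. app_sat tr \<sigma> (app_rename \<pi> s)) \<longleftrightarrow> (\<forall>u\<in>set us. app_sat tr \<sigma> u)))"

section \<open>Renaming variables and counting falsifiable applications\<close>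

lemma well_formed_arg:
  "well_formed ar cst xs a \<Longrightarrow> r \<in> set (snd a) \<Longrightarrow> (\<exists>v\<in>set xs. r = Var v) \<or> (\<exists>b. r = Const b)"
  by (rule arg.exhaust[of r]) (fastforce simp: well_formed_def)+

lemma arg_val_rename: "arg_val \<sigma> (rename_arg \<pi> r) = arg_val (\<sigma> \<circ> \<pi>) r"
  by (cases r) auto

lemma app_sat_rename: "app_sat tr \<sigma> (app_rename \<pi> a) = app_sat tr (\<sigma> \<circ> \<pi>) a"
  by (simp add: app_sat_def app_rename_def o_def arg_val_rename)

lemma well_formed_rename:
  assumes "\<And>v. v \<in> set xs \<Longrightarrow> \<pi> v \<in> set xs" "well_formed ar c xs a"
  shows "well_formed ar c xs (app_rename \<pi> a)"
proof -
  have "case rename_arg \<pi> r of Var v \<Rightarrow> v \<in> set xs | Const b \<Rightarrow> c"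
    if "case r of Var v \<Rightarrow> v \<in> set xs | Const b \<Rightarrow> c" for r
    using that assms(1) by (cases r) auto
  then show ?thesis
    using assms(2) by (auto simp: well_formed_def app_rename_def o_def)
qed

lemma app_rename_inverse:
  assumes "\<pi> permutes X"
  shows "app_rename \<pi> (app_rename (inv \<pi>) a) = a" "app_rename (inv \<pi>) (app_rename \<pi> a) = a"
proof -
  have "rename_arg \<pi> (rename_arg (inv \<pi>) r) = r" "rename_arg (inv \<pi>) (rename_arg \<pi> r) = r" for r
    by (cases r; simp add: permutes_inverses[OF assms])+
  then show "app_rename \<pi> (app_rename (inv \<pi>) a) = a" "app_rename (inv \<pi>) (app_rename \<pi> a) = a"
    by (simp_all add: app_rename_def o_def)
qed

text \<open>If the sets are equivalent, composing models with the permutation or its inverse carries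
  counterexamples from one side to the other. Conversely, if a model of the renamed
  \<open>ss\<close> falsified some \<open>u\<close> of \<open>us\<close>, then \<open>u\<close>
  would be falsifiable under \<open>us\<close>, which is absurd as every model of \<open>us\<close>
  satisfies \<open>u\<close>; the other inclusion is symmetric.\<close>

lemma falsifiable_rename:
  assumes \<pi>: "\<pi> permutes set xs"
    and ss: "\<forall>s\<in>set ss. well_formed ar True xs s" and us: "\<forall>u\<in>set us. well_formed ar True xs u"
  shows "(\<forall>\<sigma>. (\<forall>s\<in>set ss. app_sat tr \<sigma> (app_rename \<pi> s)) \<longleftrightarrow> (\<forall>u\<in>set us. app_sat tr \<sigma> u)) \<longleftrightarrow>
    app_rename \<pi> ` falsifiable ar tr xs ss = falsifiable ar tr xs us"
proof -
  note inv = app_rename_inverse[OF \<pi>]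
  have wf: "well_formed ar True xs (app_rename \<pi> a)" if "well_formed ar True xs a" for a
    using that \<pi> by (intro well_formed_rename) (auto simp: permutes_in_image)
  have wf': "well_formed ar True xs (app_rename (inv \<pi>) a)" if "well_formed ar True xs a" for a
    using that permutes_inv[OF \<pi>] by (intro well_formed_rename) (auto simp: permutes_in_image)
  have comp: "\<sigma> \<circ> inv \<pi> \<circ> \<pi> = \<sigma>" for \<sigma> :: "word \<Rightarrow> bool"
    using permutes_inv_o(2)[OF \<pi>] by (simp add: comp_assoc)
  show ?thesis
  proof
    assume eq: "\<forall>\<sigma>. (\<forall>s\<in>set ss. app_sat tr \<sigma> (app_rename \<pi> s)) \<longleftrightarrow> (\<forall>u\<in>set us. app_sat tr \<sigma> u)"
    show "app_rename \<pi> ` falsifiable ar tr xs ss = falsifiable ar tr xs us"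
    proof (intro equalityI subsetI)
      fix b assume "b \<in> app_rename \<pi> ` falsifiable ar tr xs ss"
      then obtain a \<sigma> where a: "b = app_rename \<pi> a" "well_formed ar True xs a"
          "\<forall>s\<in>set ss. app_sat tr \<sigma> s" "\<not> app_sat tr \<sigma> a"
        by (auto simp: falsifiable_def)
      have "\<forall>u\<in>set us. app_sat tr (\<sigma> \<circ> inv \<pi>) u"
        using eq a(3) by (metis app_sat_rename comp)
      moreover have "\<not> app_sat tr (\<sigma> \<circ> inv \<pi>) b"
        using a by (metis app_sat_rename comp)
      ultimately show "b \<in> falsifiable ar tr xs us" using a wf by (auto simp: falsifiable_def)
    next
      fix b assume "b \<in> falsifiable ar tr xs us"
      then obtain \<sigma> where b: "well_formed ar True xs b"
          "\<forall>u\<in>set us. app_sat tr \<sigma> u" "\<not> app_sat tr \<sigma> b"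
        by (auto simp: falsifiable_def)
      have "\<forall>s\<in>set ss. app_sat tr (\<sigma> \<circ> \<pi>) s" "\<not> app_sat tr (\<sigma> \<circ> \<pi>) (app_rename (inv \<pi>) b)"
        using eq b by (auto simp: app_sat_rename[symmetric] inv)
      then have "app_rename (inv \<pi>) b \<in> falsifiable ar tr xs ss"
        using wf'[OF b(1)] by (auto simp: falsifiable_def)
      then show "b \<in> app_rename \<pi> ` falsifiable ar tr xs ss" by (metis image_eqI inv(1))
    qed
  next
    assume eq: "app_rename \<pi> ` falsifiable ar tr xs ss = falsifiable ar tr xs us"
    show "\<forall>\<sigma>. (\<forall>s\<in>set ss. app_sat tr \<sigma> (app_rename \<pi> s)) \<longleftrightarrow> (\<forall>u\<in>set us. app_sat tr \<sigma> u)"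
    proof (intro allI iffI ballI; rule ccontr)
      fix \<sigma> u
      assume \<sigma>: "\<forall>s\<in>set ss. app_sat tr \<sigma> (app_rename \<pi> s)" "u \<in> set us" "\<not> app_sat tr \<sigma> u"
      have "\<forall>s\<in>set ss. app_sat tr (\<sigma> \<circ> \<pi>) s" "\<not> app_sat tr (\<sigma> \<circ> \<pi>) (app_rename (inv \<pi>) u)"
        using \<sigma> by (auto simp: app_sat_rename[symmetric] inv)
      then have "app_rename (inv \<pi>) u \<in> falsifiable ar tr xs ss"
        using \<sigma> us wf' by (auto simp: falsifiable_def)
      then have "u \<in> falsifiable ar tr xs us" using eq by (metis image_eqI inv(1))
      then show False using \<sigma>(2) by (auto simp: falsifiable_def)
    next
      fix \<sigma> s
      assume \<sigma>: "\<forall>u\<in>set us. app_sat tr \<sigma> u" "s \<in> set ss" "\<not> app_sat tr \<sigma> (app_rename \<pi> s)"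
      have "app_rename \<pi> s \<in> falsifiable ar tr xs us"
        using \<sigma> ss wf by (auto simp: falsifiable_def)
      then have "s \<in> falsifiable ar tr xs ss" unfolding eq[symmetric] by (metis imageE inv(2))
      then show False using \<sigma>(2) by (auto simp: falsifiable_def)
    qed
  qed
qed

text \<open>An argument is one of at most \<open>n\<close> variables or one of two constants. The
  exponent is a crude common bound for all arities and does not depend on the instance, so this is a
  polynomial in \<open>n\<close>.\<close>

definition app_bound :: "(word \<times> word) list \<Rightarrow> nat \<Rightarrow> nat" where
  "app_bound ar n = length ar * (n + 2) ^ sz ar"

lemma card_well_formed:
  "finite {a. well_formed ar True xs a} \<and> card {a. well_formed ar True xs a} \<le> app_bound ar (length xs)"
proof -
  let ?V = "Var ` set xs \<union> {Const True, Const False}"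
  let ?A = "\<lambda>(t, m). {t} \<times> {rs. set rs \<subseteq> ?V \<and> length rs = length (m :: word)}"
  have sub: "{a. well_formed ar True xs a} \<subseteq> (\<Union>p\<in>set ar. ?A p)"
  proof
    fix a assume a: "a \<in> {a. well_formed ar True xs a}"
    have "set (snd a) \<subseteq> ?V"
    proof
      fix r assume "r \<in> set (snd a)"
      then have "(\<exists>v\<in>set xs. r = Var v) \<or> (\<exists>b. r = Const b)"
        using a by (intro well_formed_arg) auto
      then show "r \<in> ?V" by auto
    qed
    then show "a \<in> (\<Union>p\<in>set ar. ?A p)"
      using a by (cases a) (auto simp: well_formed_def intro!: bexI[of _ "(fst a, map (\<lambda>_. False) (snd a))"])
  qed
  have V: "finite ?V" by simp
  have fin: "finite (?A p)" for p
    using finite_lists_length_eq[OF V] by (auto split: prod.splits)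
  have "card ?V \<le> card (Var ` set xs) + card {Const True, Const False}"
    by (rule card_Un_le)
  also have "card (Var ` set xs) \<le> length xs"
    by (rule order_trans[OF card_image_le card_length]) simp
  finally have cardV: "card ?V \<le> length xs + 2" by simp
  have len: "length m \<le> sz ar" if "(t, m) \<in> set ar" for t m
    using sz_member[OF that] sz_list_ge[of m] by (simp del: sz_list_ge)
  have card: "card (?A p) \<le> (length xs + 2) ^ sz ar" if "p \<in> set ar" for p
  proof (cases p)
    case (Pair t m)
    have "card (?A p) = card ?V ^ length m"
      unfolding Pair using card_lists_length_eq[OF V, of "length m"] by (simp add: card_cartesian_product)
    also have "\<dots> \<le> (length xs + 2) ^ length m"
      using cardV by (intro power_mono) auto
    also have "\<dots> \<le> (length xs + 2) ^ sz ar"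
      using len that Pair by (intro power_increasing) auto
    finally show ?thesis .
  qed
  have finU: "finite (\<Union>p\<in>set ar. ?A p)" using fin by blast
  have "card {a. well_formed ar True xs a} \<le> card (\<Union>p\<in>set ar. ?A p)"
    by (rule card_mono[OF finU sub])
  also have "\<dots> \<le> (\<Sum>p\<in>set ar. card (?A p))"
    by (rule card_UN_le) simp
  also have "\<dots> \<le> (\<Sum>p\<in>set ar. (length xs + 2) ^ sz ar)"
    by (rule sum_mono) (rule card)
  also have "\<dots> \<le> app_bound ar (length xs)"
    by (simp add: app_bound_def card_length)
  finally show ?thesis using finite_subset[OF sub finU] by blast
qed

lemma card_falsifiable:
  "finite (falsifiable ar tr xs ss) \<and> card (falsifiable ar tr xs ss) \<le> app_bound ar (length xs)"
proof -
  have sub: "falsifiable ar tr xs ss \<subseteq> {a. well_formed ar True xs a}"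
    by (auto simp: falsifiable_def)
  show ?thesis
    using card_well_formed[of ar xs] card_mono[OF _ sub] finite_subset[OF sub] by linarith
qed

text \<open>Variables without an entry are fixed, as a permutation of a set fixes everything outside
  it.\<close>

definition lookup :: "(word \<times> word) list \<Rightarrow> word \<Rightarrow> word" where
  "lookup ps v = fold (\<lambda>p r. if fst p = v then snd p else r) ps v"

lemma lookup_graph:
  assumes "\<pi> permutes set xs"
  shows "lookup (map (\<lambda>v. (v, \<pi> v)) xs) = \<pi>"
proof
  have "fold (\<lambda>p r. if fst p = v then snd p else r) (map (\<lambda>v. (v, \<pi> v)) ys) r =
      (if v \<in> set ys then \<pi> v else r)" for v r ys
    by (induction ys arbitrary: r) auto
  then show "lookup (map (\<lambda>v. (v, \<pi> v)) xs) v = \<pi> v" for v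
    using assms by (simp add: lookup_def permutes_not_in)
qed

text \<open>A valuation is given by the list of variables that it makes true.\<close>

definition counterexample :: "(word \<times> word) list \<Rightarrow> (word \<times> word) list \<Rightarrow> word list \<Rightarrow> app list \<Rightarrow> app \<times> word list \<Rightarrow> bool" where
  "counterexample ar tr xs ss e \<longleftrightarrow> well_formed ar True xs (fst e) \<and>
     (\<forall>s\<in>set ss. app_sat tr (\<lambda>v. v \<in> set (snd e)) s) \<and> \<not> app_sat tr (\<lambda>v. v \<in> set (snd e)) (fst e)"

definition certificate :: "(word \<times> word) list \<Rightarrow> (word \<times> word) list \<Rightarrow> word list \<Rightarrow> app list \<Rightarrow> (app \<times> word list) list \<Rightarrow> bool" where
  "certificate ar tr xs ss es \<longleftrightarrow> distinct (map fst es) \<and> (\<forall>e\<in>set es. counterexample ar tr xs ss e)"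

text \<open>Injectivity and equality of the renamed family with the other one are phrased by
  quantifiers over lists only, which the closure properties of polynomial time cover.\<close>

definition matching :: "word list \<Rightarrow> (app \<times> word list) list \<Rightarrow> (app \<times> word list) list \<Rightarrow> (word \<times> word) list \<Rightarrow> bool" where
  "matching xs es ds ps \<longleftrightarrow> (\<forall>v\<in>set xs. lookup ps v \<in> set xs) \<and>
     (\<forall>v\<in>set xs. \<forall>w\<in>set xs. lookup ps v = lookup ps w \<longrightarrow> v = w) \<and>
     (\<forall>e\<in>set es. app_rename (lookup ps) (fst e) \<in> set (map fst ds)) \<and>
     (\<forall>d\<in>set ds. \<exists>e\<in>set es. app_rename (lookup ps) (fst e) = fst d)"

lemma certificate_falsifiable:
  assumes "certificate ar tr xs ss es"
  shows "fst ` set es \<subseteq> falsifiable ar tr xs ss" "card (fst ` set es) = length es"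
    "length es \<le> card (falsifiable ar tr xs ss)"
proof -
  show 1: "fst ` set es \<subseteq> falsifiable ar tr xs ss"
    using assms unfolding certificate_def counterexample_def falsifiable_def by blast
  show 2: "card (fst ` set es) = length es"
    using assms distinct_card[of "map fst es"] by (simp add: certificate_def)
  show "length es \<le> card (falsifiable ar tr xs ss)"
    using card_mono[OF _ 1] card_falsifiable 2 by metis
qed

text \<open>Only the values at the variables in \<open>xs\<close> matter, so every model can be cut
  down to a sublist of \<open>xs\<close>.\<close>

lemma app_sat_filter:
  assumes "well_formed ar True xs a"
  shows "app_sat tr (\<lambda>v. v \<in> set (filter \<sigma> xs)) a = app_sat tr \<sigma> a"
proof -
  have "map (arg_val (\<lambda>v. v \<in> set (filter \<sigma> xs))) (snd a) = map (arg_val \<sigma>) (snd a)"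
  proof (rule map_cong[OF refl])
    fix r assume "r \<in> set (snd a)"
    then show "arg_val (\<lambda>v. v \<in> set (filter \<sigma> xs)) r = arg_val \<sigma> r"
      using well_formed_arg[OF assms] by fastforce
  qed
  then show ?thesis by (simp only: app_sat_def)
qed

lemma sz_filter: "sz (filter P xs) \<le> sz xs" for xs :: "'a::enc list"
  by (induction xs) auto

lemma sz_le_mult: "(\<And>x. x \<in> set xs \<Longrightarrow> sz x \<le> n) \<Longrightarrow> sz xs \<le> length xs * (n + 1) + 1" for xs :: "'a::enc list"
proof (induction xs)
  case (Cons a xs)
  then have "sz a \<le> n" "sz xs \<le> length xs * (n + 1) + 1" by auto
  then show ?case by simp
qed simp

lemma sz_well_formed:
  assumes "well_formed ar True xs a"
  shows "sz a \<le> sz ar + (sz ar * (sz xs + 4) + 1)"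
proof -
  obtain t rs where a: "a = (t, rs)" by (cases a)
  have m: "(t, map (\<lambda>_. False) rs) \<in> set ar" using assms a by (simp add: well_formed_def)
  have t: "sz t \<le> sz ar" "length rs \<le> sz ar"
    using sz_member[OF m] sz_list_ge[of "map (\<lambda>_. False) rs"] by simp_all
  have "sz r \<le> sz xs + 3" if "r \<in> set rs" for r
    using that well_formed_arg[OF assms, of r] sz_member[of _ xs] a by fastforce
  then have "sz rs \<le> length rs * (sz xs + 3 + 1) + 1" by (rule sz_le_mult)
  also have "\<dots> \<le> sz ar * (sz xs + 4) + 1" using mult_right_mono[OF t(2), of "sz xs + 4"] by (simp add: algebra_simps)
  finally show ?thesis using a t by simp
qed

text \<open>The size bound is the number of applications times the size of one application with a
  sublist of \<open>xs\<close> as its falsifying model, plus the list markers.\<close>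

lemma certificate_exists:
  assumes "\<forall>s\<in>set ss. well_formed ar True xs s"
  shows "\<exists>es. certificate ar tr xs ss es \<and> fst ` set es = falsifiable ar tr xs ss \<and>
    sz es \<le> app_bound ar (length xs) * (sz ar + (sz ar * (sz xs + 4) + 1) + sz xs + 1) + 1"
proof -
  let ?F = "falsifiable ar tr xs ss"
  obtain as where as: "set as = ?F" "distinct as"
    using card_falsifiable finite_distinct_list by metis
  have "\<exists>tv. counterexample ar tr xs ss (a, tv) \<and> sz tv \<le> sz xs" if a: "a \<in> ?F" for a
  proof -
    from a obtain \<sigma> where \<sigma>: "well_formed ar True xs a" "\<forall>s\<in>set ss. app_sat tr \<sigma> s" "\<not> app_sat tr \<sigma> a"
      by (auto simp: falsifiable_def)
    then have "counterexample ar tr xs ss (a, filter \<sigma> xs)"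
      using assms unfolding counterexample_def fst_conv snd_conv by (metis app_sat_filter)
    then show ?thesis using sz_filter by blast
  qed
  then obtain tv where tv: "\<And>a. a \<in> ?F \<Longrightarrow> counterexample ar tr xs ss (a, tv a) \<and> sz (tv a) \<le> sz xs"
    by metis
  let ?es = "map (\<lambda>a. (a, tv a)) as"
  have "certificate ar tr xs ss ?es"
    using as tv by (auto simp: certificate_def o_def)
  moreover have "fst ` set ?es = ?F" using as by (simp add: image_image)
  moreover have "sz ?es \<le> app_bound ar (length xs) * (sz ar + (sz ar * (sz xs + 4) + 1) + sz xs + 1) + 1"
  proof -
    have "sz (a, tv a) \<le> sz ar + (sz ar * (sz xs + 4) + 1) + sz xs" if "a \<in> ?F" for a
      using tv[OF that] sz_well_formed[of ar xs a] by (simp add: counterexample_def)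
    then have "sz e \<le> sz ar + (sz ar * (sz xs + 4) + 1) + sz xs" if "e \<in> set ?es" for e
      using that unfolding set_map as(1) by blast
    then have "sz ?es \<le> length ?es * (sz ar + (sz ar * (sz xs + 4) + 1) + sz xs + 1) + 1"
      by (rule sz_le_mult)
    moreover have "length ?es \<le> app_bound ar (length xs)"
      using card_falsifiable[of ar tr xs ss] distinct_card[OF as(2)] as(1) by simp
    ultimately show ?thesis by (meson add_right_mono le_trans mult_right_mono zero_le)
  qed
  ultimately show ?thesis by blast
qed

text \<open>As \<open>parse\<close> is total, malformed inputs are recognised by encoding the parsed value again.\<close>

definition is_instance :: "(word \<times> word) list \<Rightarrow> bool \<Rightarrow> word \<Rightarrow> word list \<times> app list \<times> app list \<Rightarrow> bool" where
  "is_instance ar cst x i \<longleftrightarrow> encode i = x \<and>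
    (\<forall>a\<in>set (fst (snd i) @ snd (snd i)). well_formed ar cst (fst i) a)"

text \<open>If the input is malformed, the first question is always answered yes and the second one no, so that
  the answers disagree.\<close>

definition verify :: "(word \<times> word) list \<Rightarrow> (word \<times> word) list \<Rightarrow> bool \<Rightarrow> word \<times> word \<times> bool \<Rightarrow>
    word list \<times> app list \<times> app list \<Rightarrow> (app \<times> word list) list \<times> (app \<times> word list) list \<times> (word \<times> word) list \<Rightarrow> bool" where
  "verify ar tr cst q i c \<longleftrightarrow>
    (if is_instance ar cst (fst q) i
     then length (fst (snd q)) \<le> length (fst c @ fst (snd c)) \<and>
       certificate ar tr (fst i) (fst (snd i)) (fst c) \<and>
       certificate ar tr (fst i) (snd (snd i)) (fst (snd c)) \<and>
       (snd (snd q) \<longrightarrow> matching (fst i) (fst c) (fst (snd c)) (snd (snd c)))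
     else \<not> snd (snd q))"

text \<open>A query encodes \<open>(x, k, b)\<close>: the raw input, a number in unary and the
  choice of the question. The input is parsed and checked only here, so that producing queries
  requires no knowledge about it.\<close>

definition accepts :: "(word \<times> word) list \<Rightarrow> (word \<times> word) list \<Rightarrow> bool \<Rightarrow> word \<Rightarrow> word \<Rightarrow> bool" where
  "accepts ar tr cst y w \<longleftrightarrow>
    verify ar tr cst (fst (parse y)) (fst (parse (fst (fst (parse y :: (word \<times> word \<times> bool) \<times> word)))))
      (fst (parse w))"

section \<open>The verifier runs in polynomial time\<close>

lemma pt_lookup:
  assumes "pt l" "pt f"
  shows "pt (\<lambda>x. lookup (l x) (f x))"
  unfolding lookup_def
proof (rule pt_fold_inv[where B = "\<lambda>x. sz (l x)" and I = "\<lambda>_ _. True"])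
  fix x p and r :: word assume "p \<in> set (l x)"
  then have "sz p \<le> sz (l x)" by (rule sz_member)
  then show "True \<and> sz (if fst p = f x then snd p else r) \<le> sz r + sz (l x)" by (cases p) auto
qed (intro assms pt_intros pt_eq pt_comp[OF assms(2)] poly_bdd_intros TrueI)+

lemma arg_val_case: "arg_val \<sigma> = (\<lambda>r. case r of Var v \<Rightarrow> \<sigma> v | Const b \<Rightarrow> b)"
  by (auto simp: fun_eq_iff split: arg.split)

lemma rename_arg_case: "rename_arg \<pi> = (\<lambda>r. case r of Var v \<Rightarrow> Var (\<pi> v) | Const b \<Rightarrow> Const b)"
  by (auto simp: fun_eq_iff split: arg.split)

lemmas pt_rules = pt_intros pt_Not pt_conj pt_imp pt_iff pt_ball pt_bex pt_append pt_map pt_member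
  pt_distinct pt_length_le pt_lookup pt_eq

lemma pt_well_formed:
  assumes "pt f" "pt g"
  shows "pt (\<lambda>x. well_formed ar cst (f x) (g x))"
  unfolding well_formed_def by (intro pt_rules assms pt_comp[OF assms(1)])

lemma pt_app_sat:
  assumes "pt f" "pt g"
  shows "pt (\<lambda>x. app_sat tr (\<lambda>v. v \<in> set (f x)) (g x))"
  unfolding app_sat_def arg_val_case by (intro pt_rules assms pt_comp[OF assms(1)])

lemma pt_app_rename:
  assumes "pt f" "pt g"
  shows "pt (\<lambda>x. app_rename (lookup (f x)) (g x))"
  unfolding app_rename_def rename_arg_case by (intro pt_rules assms pt_comp[OF assms(1)])

lemma pt_certificate:
  assumes "pt f" "pt g" "pt h"
  shows "pt (\<lambda>x. certificate ar tr (f x) (g x) (h x))"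
  unfolding certificate_def counterexample_def
  by (intro pt_rules pt_well_formed pt_app_sat assms pt_comp[OF assms(1)] pt_comp[OF assms(2)])

lemma pt_matching:
  assumes "pt f" "pt g" "pt h" "pt k"
  shows "pt (\<lambda>x. matching (f x) (g x) (h x) (k x))"
  unfolding matching_def
  by (intro pt_rules pt_app_rename assms pt_comp[OF assms(1)] pt_comp[OF assms(2)] pt_comp[OF assms(3)]
    pt_comp[OF assms(4)])

lemma pt_is_instance:
  assumes "pt f" "pt g"
  shows "pt (\<lambda>x. is_instance ar cst (f x) (g x))"
  unfolding is_instance_def
  by (intro pt_rules pt_well_formed assms pt_comp[OF assms(2)])

lemma pt_verify:
  assumes "pt f" "pt g" "pt h"
  shows "pt (\<lambda>x. verify ar tr cst (f x) (g x) (h x))"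
  unfolding verify_def
  by (intro pt_rules pt_is_instance pt_certificate pt_matching assms)

lemmas pt_parses = pt_parse_bool pt_parse_prod pt_parse_list pt_parse_arg

lemma pt_accepts:
  assumes "pt f" "pt g"
  shows "pt (\<lambda>x. accepts ar tr cst (f x) (g x))"
proof -
  have 1: "pt (parse :: word \<Rightarrow> (word \<times> word \<times> bool) \<times> word)"
    by (intro pt_parses)
  have 2: "pt (parse :: word \<Rightarrow> (word list \<times> app list \<times> app list) \<times> word)"
    by (intro pt_parses)
  have 3: "pt (parse :: word \<Rightarrow> ((app \<times> word list) list \<times> (app \<times> word list) list \<times> (word \<times> word) list) \<times> word)"
    by (intro pt_parses)
  show ?thesis
    unfolding accepts_def
    by (intro pt_verify pt_rules pt_comp[OF 1] pt_comp[OF 2] pt_comp[OF 3] assms)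
qed


section \<open>Isomorphism with parallel queries\<close>

lemma well_formed_weaken: "well_formed ar cst xs a \<Longrightarrow> well_formed ar True xs a"
  by (auto simp: well_formed_def split: arg.splits)

lemma app_isomorphic_falsifiable:
  assumes "\<forall>s\<in>set ss. well_formed ar True xs s" "\<forall>u\<in>set us. well_formed ar True xs u"
  shows "app_isomorphic tr xs ss us \<longleftrightarrow>
    (\<exists>\<pi>. \<pi> permutes set xs \<and> app_rename \<pi> ` falsifiable ar tr xs ss = falsifiable ar tr xs us)"
  unfolding app_isomorphic_def
  by (intro arg_cong[where f = Ex] ext conj_cong refl falsifiable_rename[OF _ assms])

text \<open>An injective map of a finite set into itself is a permutation. Making the map the
  identity outside \<open>xs\<close> does not affect applications over \<open>xs\<close>.\<close>

lemma matching_permutation: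
  assumes m: "matching xs es ds ps"
    and es: "fst ` set es = falsifiable ar tr xs ss" and ds: "fst ` set ds = falsifiable ar tr xs us"
  shows "\<exists>\<pi>. \<pi> permutes set xs \<and> app_rename \<pi> ` falsifiable ar tr xs ss = falsifiable ar tr xs us"
proof -
  define \<pi> where "\<pi> v = (if v \<in> set xs then lookup ps v else v)" for v
  have inj: "inj_on \<pi> (set xs)" and sub: "\<pi> ` set xs \<subseteq> set xs"
    using m by (auto simp: matching_def \<pi>_def inj_on_def)
  have "\<pi> ` set xs = set xs" by (rule endo_inj_surj[OF _ sub inj]) simp
  then have perm: "\<pi> permutes set xs"
    using inj by (intro bij_imp_permutes) (auto simp: bij_betw_def \<pi>_def)
  have rn: "app_rename \<pi> a = app_rename (lookup ps) a" if "a \<in> falsifiable ar tr xs ss" for a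
  proof -
    have wf: "well_formed ar True xs a" using that by (simp add: falsifiable_def)
    have "rename_arg \<pi> r = rename_arg (lookup ps) r" if "r \<in> set (snd a)" for r
      using well_formed_arg[OF wf that] by (auto simp: \<pi>_def)
    then show ?thesis by (simp add: app_rename_def)
  qed
  have "app_rename \<pi> ` falsifiable ar tr xs ss = app_rename (lookup ps) ` fst ` set es"
    unfolding es by (rule image_cong[OF refl rn])
  also have "\<dots> = fst ` set ds"
  proof (intro equalityI subsetI)
    fix b assume "b \<in> app_rename (lookup ps) ` fst ` set es"
    then obtain e where "e \<in> set es" "b = app_rename (lookup ps) (fst e)" by blast
    then show "b \<in> fst ` set ds" using m unfolding matching_def set_map by blast
  next
    fix b assume "b \<in> fst ` set ds"
    then obtain d where "d \<in> set ds" "b = fst d" by blast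
    then obtain e where "e \<in> set es" "app_rename (lookup ps) (fst e) = b"
      using m unfolding matching_def by blast
    then show "b \<in> app_rename (lookup ps) ` fst ` set es" by blast
  qed
  finally show ?thesis using perm ds by auto
qed

lemma is_instance_well_formed:
  assumes "is_instance ar cst x (xs, ss, us)"
  shows "\<forall>s\<in>set ss. well_formed ar True xs s" "\<forall>u\<in>set us. well_formed ar True xs u"
  using assms by (auto simp: is_instance_def intro!: well_formed_weaken[of ar cst])

lemma verify_sound:
  assumes i: "is_instance ar cst x (xs, ss, us)"
    and v: "verify ar tr cst (x, k, b) (xs, ss, us) (es, ds, ps)"
  shows "length k \<le> card (falsifiable ar tr xs ss) + card (falsifiable ar tr xs us)"
    "b \<Longrightarrow> length k = card (falsifiable ar tr xs ss) + card (falsifiable ar tr xs us) \<Longrightarrow>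
      app_isomorphic tr xs ss us"
proof -
  have es: "certificate ar tr xs ss es" and ds: "certificate ar tr xs us ds"
    and k: "length k \<le> length es + length ds"
    and m: "b \<longrightarrow> matching xs es ds ps"
    using i v by (auto simp: verify_def)
  note es = certificate_falsifiable[OF es] and ds = certificate_falsifiable[OF ds]
  show "length k \<le> card (falsifiable ar tr xs ss) + card (falsifiable ar tr xs us)"
    using k es ds by linarith
  assume b: b and kk: "length k = card (falsifiable ar tr xs ss) + card (falsifiable ar tr xs us)"
  \<comment> \<open>Neither family exceeds its own set, so reaching the sum of the two cardinalities
    forces equality in both.\<close>
  have len: "length es = card (falsifiable ar tr xs ss)" "length ds = card (falsifiable ar tr xs us)"
    using k kk es(3) ds(3) by linarith+
  have "fst ` set es = falsifiable ar tr xs ss"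
    by (rule card_subset_eq[OF conjunct1[OF card_falsifiable] es(1)]) (simp only: es(2) len)
  moreover have "fst ` set ds = falsifiable ar tr xs us"
    by (rule card_subset_eq[OF conjunct1[OF card_falsifiable] ds(1)]) (simp only: ds(2) len)
  ultimately obtain \<pi> where "\<pi> permutes set xs"
      "app_rename \<pi> ` falsifiable ar tr xs ss = falsifiable ar tr xs us"
    using matching_permutation m b by metis
  then show "app_isomorphic tr xs ss us"
    using app_isomorphic_falsifiable[OF is_instance_well_formed[OF i]] by blast
qed

text \<open>Twice the bound of \<open>certificate_exists\<close> plus the size of the graph of a permutation, at
  \<open>n \<ge> sz xs\<close>.\<close>

definition witness_bound :: "(word \<times> word) list \<Rightarrow> nat poly" where
  "witness_bound ar =
     2 * ([:length ar:] * [:2, 1:] ^ sz ar * ([:sz ar:] + ([:sz ar:] * [:4, 1:] + 1) + [:0, 1:] + 1) + 1)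
     + ([:0, 1:] * ([:0, 2:] + 1) + 1)"

text \<open>The number \<open>k\<close> is only a lower bound on what is certified. So the two
  complete families, together with the graph of the permutation, answer every query up to the
  total.\<close>

lemma verify_complete:
  assumes i: "is_instance ar cst x (xs, ss, us)"
    and \<pi>: "\<pi> permutes set xs"
    and b: "b \<longrightarrow> app_rename \<pi> ` falsifiable ar tr xs ss = falsifiable ar tr xs us"
    and k: "length k \<le> card (falsifiable ar tr xs ss) + card (falsifiable ar tr xs us)"
    and n: "sz xs \<le> n"
  shows "\<exists>c. verify ar tr cst (x, k, b) (xs, ss, us) c \<and> sz c \<le> poly (witness_bound ar) n"
proof -
  \<comment> \<open>Both \<open>length xs\<close> and \<open>sz xs\<close> are replaced by the
    common bound \<open>n\<close>, in which the certificate bound is a polynomial.\<close>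
  define N where "N m = app_bound ar m * (sz ar + (sz ar * (m + 4) + 1) + m + 1) + 1" for m
  have mono: "app_bound ar (length xs) * (sz ar + (sz ar * (sz xs + 4) + 1) + sz xs + 1) + 1 \<le> N n"
  proof -
    have "length xs \<le> n" using sz_list_ge[of xs] n by (simp del: sz_list_ge)
    then show ?thesis
      unfolding N_def app_bound_def using n
      by (intro add_right_mono mult_mono power_mono add_left_mono add_mono) auto
  qed
  note wf = is_instance_well_formed[OF i]
  obtain es where "certificate ar tr xs ss es" "fst ` set es = falsifiable ar tr xs ss"
      "sz es \<le> app_bound ar (length xs) * (sz ar + (sz ar * (sz xs + 4) + 1) + sz xs + 1) + 1"
    using certificate_exists[OF wf(1)] by blast
  note es = this(1,2) order_trans[OF this(3) mono]
  obtain ds where "certificate ar tr xs us ds" "fst ` set ds = falsifiable ar tr xs us"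
      "sz ds \<le> app_bound ar (length xs) * (sz ar + (sz ar * (sz xs + 4) + 1) + sz xs + 1) + 1"
    using certificate_exists[OF wf(2)] by blast
  note ds = this(1,2) order_trans[OF this(3) mono]
  let ?ps = "map (\<lambda>v. (v, \<pi> v)) xs"
  have look: "lookup ?ps = \<pi>" by (rule lookup_graph[OF \<pi>])
  \<comment> \<open>Both components of an entry are members of \<open>xs\<close>, as the permutation
    maps this set to itself.\<close>
  have "sz p \<le> 2 * n" if p: "p \<in> set ?ps" for p
  proof -
    obtain v where v: "p = (v, \<pi> v)" "v \<in> set xs" using p by auto
    then have "\<pi> v \<in> set xs" using permutes_in_image[OF \<pi>] by simp
    then show ?thesis using v sz_member[of v xs] sz_member[of "\<pi> v" xs] n by simp
  qed
  then have "sz ?ps \<le> length ?ps * (2 * n + 1) + 1" by (rule sz_le_mult)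
  also have "\<dots> \<le> n * (2 * n + 1) + 1"
    using sz_list_ge[of xs] n by (intro add_right_mono mult_right_mono) (auto simp del: sz_list_ge)
  finally have ps: "sz ?ps \<le> n * (2 * n + 1) + 1" .
  have "matching xs es ds ?ps" if b
  proof -
    have eq: "app_rename \<pi> ` fst ` set es = fst ` set ds"
      using b that es(2) ds(2) by simp
    have "\<exists>e\<in>set es. app_rename \<pi> (fst e) = fst d" if "d \<in> set ds" for d
      using that eq by (metis (no_types, lifting) imageE imageI)
    moreover have "app_rename \<pi> (fst e) \<in> set (map fst ds)" if "e \<in> set es" for e
      unfolding set_map eq[symmetric] using that by blast
    ultimately show ?thesis
      unfolding matching_def look using permutes_in_image[OF \<pi>] permutes_inj[OF \<pi>]
      by (auto dest: injD)
  qed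
  moreover have "length es = card (falsifiable ar tr xs ss)" "length ds = card (falsifiable ar tr xs us)"
    using certificate_falsifiable(2)[OF es(1)] certificate_falsifiable(2)[OF ds(1)] es(2) ds(2) by simp_all
  ultimately have "verify ar tr cst (x, k, b) (xs, ss, us) (es, ds, ?ps)"
    using i es ds k by (simp add: verify_def)
  moreover have "poly (witness_bound ar) n = 2 * N n + (n * (2 * n + 1) + 1)"
    by (simp add: witness_bound_def N_def app_bound_def algebra_simps)
  then have "sz (es, ds, ?ps) \<le> poly (witness_bound ar) n"
    using es(3) ds(3) ps by simp
  ultimately show ?thesis by blast
qed

text \<open>The factor 2 accounts for the two falsifiable sets, and \<open>length x\<close> bounds
  the number of variables. The number 0 is added by hand since \<open>tails\<close> yields nonempty
  lists only. The two questions for one number are adjacent.\<close>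

definition queries :: "(word \<times> word) list \<Rightarrow> word \<Rightarrow> word list" where
  "queries ar x = concat (map (\<lambda>k :: bool list. [encode (x, k, False), encode (x, k, True)])
     ([] # tails (replicate (poly (2 * ([:length ar:] * [:2, 1:] ^ sz ar)) (length x)) True)))"

text \<open>The first component of the state stores the first answer of a pair until the second one
  arrives.\<close>

definition pairs_agree :: "bool list \<Rightarrow> bool" where
  "pairs_agree as = snd (fold (\<lambda>b st. case fst st of [] \<Rightarrow> ([b], snd st) | c # cs \<Rightarrow> ([], snd st \<and> (b \<longleftrightarrow> c)))
     as ([], True))"

lemma pairs_agree_concat: "pairs_agree (concat (map (\<lambda>k. [f k, g k]) ks)) \<longleftrightarrow> (\<forall>k\<in>set ks. f k = g k)"
proof -
  have "fold (\<lambda>b st. case fst st of [] \<Rightarrow> ([b], snd st) | c # cs \<Rightarrow> ([], snd st \<and> (b \<longleftrightarrow> c)))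
      (concat (map (\<lambda>k. [f k, g k]) ks)) ([], ok) = ([], ok \<and> (\<forall>k\<in>set ks. f k = g k))" for ok
    by (induction ks arbitrary: ok) auto
  then show ?thesis by (simp add: pairs_agree_def)
qed

lemma pt_pairs_agree:
  assumes "pt f"
  shows "pt (\<lambda>x. pairs_agree (f x))"
  unfolding pairs_agree_def
  by (intro pt_sndI pt_fold_inv[where B = "\<lambda>x. 2" and I = "\<lambda>_ _. True"])
    (auto intro!: pt_rules assms poly_bdd_const split: list.split)

lemma encode_word_eq: "encode = enc_word"
  by (simp add: fun_eq_iff encode_list_def enc_word_def encode_bool_def[abs_def])

lemma pair_word_encode: "pair_word x y = encode (x, y)"
  by (simp add: pair_word_def encode_word_eq)

lemma parse_encode_fst [simp]: "fst (parse (encode x)) = x"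
  using parse_encode[of x "[]"] by simp

lemma pt_queries: "pt (queries ar)"
  unfolding queries_def[abs_def]
  by (intro pt_rules pt_concat pt_tails pt_replicate_poly)

text \<open>Everything that depends on the structure of the instance, even its syntax check, is left
  to the oracle: the queries copy \<open>x\<close> and use its length, and \<open>D\<close> merely
  compares neighbouring answers.\<close>

lemma isomorphism_in_class_P_NP_par:
  "{x. \<exists>xs ss us. is_instance ar cst x (xs, ss, us) \<and> app_isomorphic tr xs ss us} \<in> class_P_NP_par"
  (is "?B \<in> _")
proof -
  define A where "A = {y. \<exists>w. length w \<le> poly (witness_bound ar) (length y) \<and> accepts ar tr cst y w}"
  define R where "R = {z. accepts ar tr cst (fst (fst (parse z :: (word \<times> word) \<times> word)))
    (snd (fst (parse z :: (word \<times> word) \<times> word)))}"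
  define D where "D = {z. pairs_agree (snd (fst (parse z :: (word \<times> word) \<times> word)))}"
  have pair: "pt (parse :: word \<Rightarrow> (word \<times> word) \<times> word)"
    by (intro pt_parses)
  have "R \<in> class_P"
    unfolding R_def by (intro class_P_pt pt_accepts pt_fstI pt_sndI pair)
  moreover have "y \<in> A \<longleftrightarrow> (\<exists>w. length w \<le> poly (witness_bound ar) (length y) \<and> pair_word y w \<in> R)" for y
    by (simp add: A_def R_def pair_word_encode del: encode_prod.simps)
  ultimately have A: "A \<in> class_NP" unfolding class_NP_def by blast
  have D: "D \<in> class_P"
    unfolding D_def by (intro class_P_pt pt_pairs_agree pt_fstI pt_sndI pair)
  have Q: "poly_time_computable (\<lambda>x. enc_list enc_word (queries ar x))"
    using poly_time_computable_pt[OF pt_queries] by (simp add: encode_list_def encode_word_eq[symmetric])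
  have "x \<in> ?B \<longleftrightarrow> pair_word x (map (\<lambda>q. q \<in> A) (queries ar x)) \<in> D" for x
  proof -
    let ?L = "poly (2 * ([:length ar:] * [:2, 1:] ^ sz ar)) (length x)"
    let ?ks = "[] # tails (replicate ?L True)"
    have q: "pair_word x (map (\<lambda>q. q \<in> A) (queries ar x)) \<in> D \<longleftrightarrow>
        (\<forall>k\<in>set ?ks. (encode (x, k, False) \<in> A) = (encode (x, k, True) \<in> A))"
      using pairs_agree_concat[of "\<lambda>k. encode (x, k, False) \<in> A" "\<lambda>k. encode (x, k, True) \<in> A" ?ks]
      by (simp add: D_def queries_def pair_word_encode map_concat o_def del: encode_prod.simps)
    have acc: "accepts ar tr cst (encode (x, k, b)) w = verify ar tr cst (x, k, b) (fst (parse x)) (fst (parse w))"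
      for k b w
      by (simp add: accepts_def del: encode_prod.simps)
    show ?thesis
    proof (cases "\<exists>i. is_instance ar cst x i")
      case False
      then have "\<not> is_instance ar cst x (fst (parse x))" by blast
      then have "encode (x, [] :: bool list, False) \<in> A" "encode (x, [] :: bool list, True) \<notin> A"
        unfolding A_def by (auto simp: acc verify_def simp del: encode_prod.simps intro!: exI[of _ "[]"])
      then show ?thesis using q False by auto
    next
      case True
      then obtain xs ss us where i: "is_instance ar cst x (xs, ss, us)" by (metis prod.exhaust)
      have x: "x = encode (xs, ss, us)" using i by (simp add: is_instance_def)
      have B: "x \<in> ?B \<longleftrightarrow> app_isomorphic tr xs ss us"
        using i by (auto simp: is_instance_def simp del: encode_prod.simps)
      have px: "fst (parse x) = (xs, ss, us)" unfolding x by (rule parse_encode_fst)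
      let ?n = "card (falsifiable ar tr xs ss) + card (falsifiable ar tr xs us)"
      have sound: "length k \<le> ?n" "b \<Longrightarrow> length k = ?n \<Longrightarrow> app_isomorphic tr xs ss us"
        if kA: "encode (x, k, b) \<in> A" for k :: word and b
      proof -
        obtain c where c: "verify ar tr cst (x, k, b) (xs, ss, us) c"
          using kA unfolding A_def mem_Collect_eq acc px by blast
        obtain es ds ps where "c = (es, ds, ps)" by (rule prod_cases3)
        with c have v: "verify ar tr cst (x, k, b) (xs, ss, us) (es, ds, ps)" by simp
        show "length k \<le> ?n" by (rule verify_sound(1)[OF i v])
        show "app_isomorphic tr xs ss us" if b "length k = ?n"
          by (rule verify_sound(2)[OF i v that])
      qed
      have complete: "encode (x, k, b) \<in> A"
        if hyps: "length k \<le> ?n" "\<pi> permutes set xs"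
          "b \<longrightarrow> app_rename \<pi> ` falsifiable ar tr xs ss = falsifiable ar tr xs us" for k :: word and b \<pi>
      proof -
        \<comment> \<open>The witness bound must hold at the length of the query; the query contains
          \<open>x\<close>, and \<open>x\<close> contains the encoding of \<open>xs\<close>.\<close>
        have "sz xs \<le> length x" by (simp add: x)
        also have "\<dots> \<le> sz (x, k, b)" using sz_list_ge[of x] by (simp del: sz_list_ge)
        finally obtain c where "verify ar tr cst (x, k, b) (xs, ss, us) c"
            "sz c \<le> poly (witness_bound ar) (sz (x, k, b))"
          using verify_complete[OF i hyps(2,3,1)] by blast
        then show ?thesis
          unfolding A_def mem_Collect_eq acc px by (intro exI[of _ "encode c"]) simp
      qed
      have plain: "encode (x, k, False) \<in> A \<longleftrightarrow> length k \<le> ?n" for k :: word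
        \<comment> \<open>The first question ignores the permutation, so the identity will
          do.\<close>
        using sound(1)[of k False] complete[of k id False] permutes_id by auto
      show ?thesis unfolding B q
      proof
        assume "app_isomorphic tr xs ss us"
        then obtain \<pi> where \<pi>: "\<pi> permutes set xs"
            "app_rename \<pi> ` falsifiable ar tr xs ss = falsifiable ar tr xs us"
          using app_isomorphic_falsifiable[OF is_instance_well_formed[OF i]] by blast
        \<comment> \<open>With an isomorphism at hand, both answers are yes up to the total and no
          beyond it.\<close>
        show "\<forall>k\<in>set ?ks. (encode (x, k, False) \<in> A) = (encode (x, k, True) \<in> A)"
          using plain sound(1)[of _ True] complete[OF _ \<pi>(1), of _ True] \<pi>(2) by blast
      next
        assume eq: "\<forall>k\<in>set ?ks. (encode (x, k, False) \<in> A) = (encode (x, k, True) \<in> A)"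
        have "length xs \<le> length x"
          using sz_list_ge[of xs] by (simp add: x del: sz_list_ge)
        then have "app_bound ar (length xs) \<le> app_bound ar (length x)"
          unfolding app_bound_def by (intro mult_left_mono power_mono) auto
        moreover have "?L = 2 * app_bound ar (length x)"
          by (simp add: app_bound_def)
        ultimately have n: "?n \<le> ?L"
          using card_falsifiable[of ar tr xs ss] card_falsifiable[of ar tr xs us] by linarith
        \<comment> \<open>Some pair of queries asks about the exact total: 0 is represented by
          \<open>[]\<close>, a positive total by a suffix of the \<open>?L\<close> marks.\<close>
        have "\<exists>k\<in>set ?ks. length k = ?n"
        proof (cases "?n = 0")
          case False
          then have "?L - ?n < ?L" using n by linarith
          then have "drop (?L - ?n) (replicate ?L True) \<in> set (tails (replicate ?L True))"
            unfolding set_tails by (intro imageI) (simp only: length_replicate lessThan_iff)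
          moreover have "length (drop (?L - ?n) (replicate ?L True)) = ?n"
            using n by (simp only: length_drop length_replicate diff_diff_cancel)
          ultimately show ?thesis by (metis list.set_intros(2))
        qed simp
        then obtain k where k: "k \<in> set ?ks" "length k = ?n" by (rule bexE)
        have "encode (x, k, True) \<in> A"
          using bspec[OF eq k(1)] plain[of k] k(2) by (simp only: order_refl)
        then show "app_isomorphic tr xs ss us"
          by (rule sound(2)) (rule TrueI, rule k(2))
      qed
    qed
  qed
  then show ?thesis unfolding class_P_NP_par_def using A D Q by blast
qed

text \<open>As \<open>\<C>\<close> is finite, its arities and the satisfying rows of its truth tables are constant lists, and
  a constraint is evaluated by a membership test. The arity \<open>k\<close> is represented by a list of length \<open>k\<close>.\<close>

definition truth_table :: "constraint \<Rightarrow> word" where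
  "truth_table c = map (snd c) (List.n_lists (fst c) [False, True])"

definition table_arities :: "constraint list \<Rightarrow> (word \<times> word) list" where
  "table_arities cs = map (\<lambda>c. (truth_table c, replicate (fst c) False)) cs"

definition table_rows :: "constraint list \<Rightarrow> (word \<times> word) list" where
  "table_rows cs = concat (map (\<lambda>c. map (Pair (truth_table c))
     (filter (snd c) (List.n_lists (fst c) [False, True]))) cs)"

definition capp_app :: "capp \<Rightarrow> app" where
  "capp_app a = (truth_table (fst a), snd a)"

definition is_capp_general :: "bool \<Rightarrow> constraint set \<Rightarrow> word set \<Rightarrow> capp \<Rightarrow> bool" where
  "is_capp_general cst C X a \<longleftrightarrow> is_capp_const C X a \<and> (cst \<or> (\<forall>r\<in>set (snd a). \<exists>v. r = Var v))"

lemma n_lists_bool: "bs \<in> set (List.n_lists k [False, True]) \<longleftrightarrow> length bs = k"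
  by (auto simp: set_n_lists)

text \<open>Different members of \<open>cs\<close> may share a truth table. Then they agree on all
  lists of the right length, so it does not matter which of them contributed the row.\<close>

lemma table_rows_iff:
  assumes "c \<in> set cs" "length bs = fst c"
  shows "(truth_table c, bs) \<in> set (table_rows cs) \<longleftrightarrow> snd c bs"
proof
  assume "(truth_table c, bs) \<in> set (table_rows cs)"
  then obtain d where d: "truth_table c = truth_table d" "length bs = fst d" "snd d bs"
    by (auto simp: table_rows_def n_lists_bool)
  then show "snd c bs"
    using assms(2) by (simp add: truth_table_def n_lists_bool)
next
  assume "snd c bs"
  then show "(truth_table c, bs) \<in> set (table_rows cs)"
    using assms by (auto simp: table_rows_def n_lists_bool)
qed

section \<open>Applications of constraints and applications of truth tables\<close>

lemma well_formed_capp_app: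
  assumes "set cs = C" "is_capp_general cst C (set xs) a"
  shows "well_formed (table_arities cs) cst xs (capp_app a)"
proof -
  have "map (\<lambda>_. False) (snd a) = replicate (fst (fst a)) False"
    using assms by (simp add: is_capp_general_def is_capp_const_def map_replicate_const)
  moreover have "case r of Var v \<Rightarrow> v \<in> set xs | Const b \<Rightarrow> cst" if "r \<in> set (snd a)" for r
    using assms that by (fastforce simp: is_capp_general_def is_capp_const_def split: arg.split)
  ultimately show ?thesis
    using assms by (auto simp: well_formed_def capp_app_def table_arities_def
      is_capp_general_def is_capp_const_def)
qed

text \<open>Constraints that differ only on lists of the wrong length are identified by
  \<open>capp_app\<close>, so it need not be injective. A preimage suffices, because the isomorphism
  problems only ask for some instance with the given encoding.\<close>

lemma well_formed_capp_app_surj: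
  assumes "set cs = C" "well_formed (table_arities cs) cst xs b"
  shows "\<exists>a. capp_app a = b \<and> is_capp_general cst C (set xs) a"
proof -
  obtain c where c: "c \<in> C" "fst b = truth_table c" "map (\<lambda>_. False) (snd b) = replicate (fst c) False"
    using assms by (auto simp: well_formed_def table_arities_def)
  have len: "length (snd b) = fst c" using arg_cong[OF c(3), of length] by simp
  have r: "case r of Var v \<Rightarrow> v \<in> set xs | Const b \<Rightarrow> cst" if "r \<in> set (snd b)" for r
    using assms(2) that by (simp add: well_formed_def)
  have "arg_vars r \<subseteq> set xs" "cst \<or> (\<exists>v. r = Var v)" if "r \<in> set (snd b)" for r
    using r[OF that] by (atomize(full), cases r) auto
  then have "is_capp_general cst C (set xs) (c, snd b)"
    using c len by (auto simp: is_capp_general_def is_capp_const_def)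
  moreover have "capp_app (c, snd b) = b" using c by (simp add: capp_app_def prod_eq_iff)
  ultimately show ?thesis by blast
qed

lemma app_sat_capp_app:
  assumes "set cs = C" "is_capp_general cst C X a"
  shows "app_sat (table_rows cs) \<sigma> (capp_app a) \<longleftrightarrow> snd (fst a) (map (arg_val \<sigma>) (snd a))"
  unfolding app_sat_def capp_app_def fst_conv snd_conv
  using assms by (intro table_rows_iff) (auto simp: is_capp_general_def is_capp_const_def)

lemma satisfies_iff: "satisfies \<sigma> S \<longleftrightarrow> (\<forall>a\<in>S. snd (fst a) (map (arg_val \<sigma>) (snd a)))"
  by (auto simp: satisfies_def split: prod.splits)

lemma satisfies_rename: "satisfies \<sigma> (rename \<pi> S) = satisfies (\<sigma> \<circ> \<pi>) S"
  by (simp add: satisfies_iff rename_def case_prod_unfold o_def arg_val_rename)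

lemma isomorphic_iff:
  assumes "set cs = C" "\<forall>a\<in>set ss \<union> set us. is_capp_general cst C (set xs) a"
  shows "isomorphic (set xs) (set ss) (set us) \<longleftrightarrow>
    app_isomorphic (table_rows cs) xs (map capp_app ss) (map capp_app us)"
proof -
  have "satisfies \<sigma> (set as) \<longleftrightarrow> (\<forall>a\<in>set as. app_sat (table_rows cs) \<sigma> (capp_app a))"
    if "set as \<subseteq> set ss \<union> set us" for \<sigma> as
    unfolding satisfies_iff
    by (intro ball_cong refl app_sat_capp_app[OF assms(1), where cst = cst and X = "set xs", symmetric])
      (use assms(2) that in blast)
  then show ?thesis
    by (simp add: isomorphic_def app_isomorphic_def equivalent_def satisfies_rename app_sat_rename)
qed

lemma enc_capp_app: "enc_capp a = encode (capp_app a)"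
  by (cases a rule: enc_capp.cases; cases "fst a")
    (auto simp: capp_app_def truth_table_def encode_word_eq encode_list_def encode_arg_def[abs_def])

lemma enc_instance_encode: "enc_instance xs ss us = encode (xs, map capp_app ss, map capp_app us)"
proof -
  have "enc_list enc_capp as = encode (map capp_app as)" for as
    by (simp add: encode_list_def enc_list_def enc_capp_app o_def)
  moreover have "enc_list enc_word xs = encode xs"
    by (subst encode_list_def) (simp add: encode_word_eq)
  ultimately show ?thesis by (simp add: enc_instance_def)
qed

lemma instances_eq:
  assumes "set cs = C"
  shows "{enc_instance xs ss us | xs ss us.
      (\<forall>a\<in>set ss \<union> set us. is_capp_general cst C (set xs) a) \<and> isomorphic (set xs) (set ss) (set us)} =
    {x. \<exists>xs ss us. is_instance (table_arities cs) cst x (xs, ss, us) \<and>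
      app_isomorphic (table_rows cs) xs ss us}" (is "?A = ?B")
proof (intro equalityI subsetI)
  fix x assume "x \<in> ?A"
  then obtain xs ss us where x: "x = enc_instance xs ss us"
      "\<forall>a\<in>set ss \<union> set us. is_capp_general cst C (set xs) a" "isomorphic (set xs) (set ss) (set us)"
    by blast
  have "is_instance (table_arities cs) cst x (xs, map capp_app ss, map capp_app us)"
    using x(1,2) well_formed_capp_app[OF assms] by (auto simp: is_instance_def enc_instance_encode)
  then show "x \<in> ?B" using isomorphic_iff[OF assms x(2)] x(3) by blast
next
  fix x assume "x \<in> ?B"
  then obtain xs ss' us' where x: "is_instance (table_arities cs) cst x (xs, ss', us')"
      "app_isomorphic (table_rows cs) xs ss' us'"
    by blast
  have lift: "\<exists>as. map capp_app as = bs \<and> (\<forall>a\<in>set as. is_capp_general cst C (set xs) a)"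
    if "\<forall>b\<in>set bs. well_formed (table_arities cs) cst xs b" for bs
    using that
  proof (induction bs)
    case (Cons b bs)
    then obtain a as where "capp_app a = b" "is_capp_general cst C (set xs) a"
        "map capp_app as = bs" "\<forall>a\<in>set as. is_capp_general cst C (set xs) a"
      using well_formed_capp_app_surj[OF assms] by (metis list.set_intros)
    then show ?case by (intro exI[of _ "a # as"]) simp
  qed simp
  obtain ss where ss: "map capp_app ss = ss'" "\<forall>a\<in>set ss. is_capp_general cst C (set xs) a"
    using lift[of ss'] x(1) unfolding is_instance_def by auto
  obtain us where us: "map capp_app us = us'" "\<forall>a\<in>set us. is_capp_general cst C (set xs) a"
    using lift[of us'] x(1) unfolding is_instance_def by auto
  have all: "\<forall>a\<in>set ss \<union> set us. is_capp_general cst C (set xs) a" using ss us by blast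
  moreover have "x = enc_instance xs ss us"
    using x(1) ss us by (simp add: is_instance_def enc_instance_encode)
  moreover have "isomorphic (set xs) (set ss) (set us)"
    using isomorphic_iff[OF assms all] x(2) ss us by simp
  ultimately show "x \<in> ?A" by blast
qed

theorem theorem21:
  fixes \<C> :: "constraint set"
  assumes "finite \<C>"
  shows "ISO \<C> \<in> class_P_NP_par \<and> ISO_c \<C> \<in> class_P_NP_par"
proof -
  obtain cs where cs: "set cs = \<C>" using assms finite_list by blast
  have "ISO \<C> = {enc_instance xs ss us | xs ss us.
      (\<forall>a\<in>set ss \<union> set us. is_capp_general False \<C> (set xs) a) \<and> isomorphic (set xs) (set ss) (set us)}"
    by (simp add: ISO_def is_capp_def is_capp_general_def)
  moreover have "ISO_c \<C> = {enc_instance xs ss us | xs ss us.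
      (\<forall>a\<in>set ss \<union> set us. is_capp_general True \<C> (set xs) a) \<and> isomorphic (set xs) (set ss) (set us)}"
    by (simp add: ISO_c_def is_capp_general_def)
  ultimately show ?thesis
    unfolding instances_eq[OF cs] by (simp only: isomorphism_in_class_P_NP_par)
qed

end
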